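(* Let $\Gamma$ be a recursive game with $n$-stage values $v_n:X\to[-1,1]$ and $\lambda$-discounted values $v_\lambda:X\to[-1,1]$. Then $(v_n)_{n\ge1}$ converges uniformly on $X$ as $n\to\infty$ if and only if $(v_\lambda)_{\lambda\in(0,1]}$ converges uniformly on $X$ as $\lambda\to0$. In case of convergence, both limits are the same.
   Context: A two-player zero-sum stochastic game $\Gamma=\langle X,A,B,g,q\rangle$ consists of a state space $X$ (a set), action sets $A,B$ with nonempty finite subsets $A(x)\subseteq A$, $B(x)\subseteq B$ of available actions for each $x\in X$, a payoff function $g:X\times A\times B\to[-1,1]$, and a transition function $q:X\times A\times B\to\Delta_f(X)$, where $\Delta_f(X)$ is the set of finitely supported probabilities on $X$. From an initial state $x_1$, at each stage $t\ge1$, both players, knowing $(x_1,a_1,b_1,\dots,a_{t-1},b_{t-1},x_t)$, simultaneously choose $a_t\in A(x_t)$, $b_t\in B(x_t)$; the stage payoff is $g(x_t,a_t,b_t)$, and $x_{t+1}$ is drawn from $q(x_t,a_t,b_t)$. $\Gamma$ is recursive if $X=X^0\cup X^*$ (disjoint) where $g(x,a,b)=0$ for all $x\in X^0$ (active states) and all $(a,b)\in A(x)\times B(x)$, and every $x\in X^*$ is absorbing: $q(x,a,b)(x)=1$ for all $(a,b)\in A(x)\times B(x)$ and $g(x,a,b)$ depends only on $x$. $H_t=(X\times A\times B)^{t-1}\times X$. A (behavior) strategy of player 1 is a sequence $\sigma=(\sigma_t)_{t\ge1}$ with $\sigma_t:H_t\to\Delta(A)$ and $\sigma_t(h_t)(A(x_t))=1$;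 similarly for player 2. $\mathbb E_{x_1,\sigma,\tau}$ is the expectation on plays induced by $(x_1,\sigma,\tau)$. Player 1 maximizes, player 2 minimizes. $v_n(x_1)$ is the value of the game with payoff $\gamma_n(x_1,\sigma,\tau)=\mathbb E_{x_1,\sigma,\tau}\big(\frac1n\sum_{t=1}^n g(x_t,a_t,b_t)\big)$, and $v_\lambda(x_1)$ is the value of the game with payoff $\gamma_\lambda(x_1,\sigma,\tau)=\mathbb E_{x_1,\sigma,\tau}\big(\lambda\sum_{t=1}^\infty(1-\lambda)^{t-1}g(x_t,a_t,b_t)\big)$. *)

theory Defs
  imports "HOL-Probability.Probability"
begin

text \<open>
  The state space \<open>X\<close> and the action sets \<open>A\<close>, \<open>B\<close> are the types \<^typ>\<open>'x\<close>, \<^typ>\<open>'a\<close>, \<^typ>\<open>'b\<close>;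
  they may have any cardinality.
\<close>

record ('x, 'a, 'b) stoch_game =
  actions1 :: "'x \<Rightarrow> 'a set"
  actions2 :: "'x \<Rightarrow> 'b set"
  payoff :: "'x \<Rightarrow> 'a \<Rightarrow> 'b \<Rightarrow> real"
  trans_prob :: "'x \<Rightarrow> 'a \<Rightarrow> 'b \<Rightarrow> 'x pmf"

definition stochastic_game :: "('x, 'a, 'b) stoch_game \<Rightarrow> bool" where
  "stochastic_game G \<longleftrightarrow>
     (\<forall>x. finite (actions1 G x) \<and> actions1 G x \<noteq> {}) \<and>
     (\<forall>x. finite (actions2 G x) \<and> actions2 G x \<noteq> {}) \<and>
     (\<forall>x a b. payoff G x a b \<in> {-1..1}) \<and>
     (\<forall>x a b. finite (set_pmf (trans_prob G x a b)))"

definition absorbing_state :: "('x, 'a, 'b) stoch_game \<Rightarrow> 'x \<Rightarrow> bool" where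
  "absorbing_state G x \<longleftrightarrow>
     (\<forall>a\<in>actions1 G x. \<forall>b\<in>actions2 G x. pmf (trans_prob G x a b) x = 1) \<and>
     (\<exists>c. \<forall>a\<in>actions1 G x. \<forall>b\<in>actions2 G x. payoff G x a b = c)"

definition recursive_game :: "('x, 'a, 'b) stoch_game \<Rightarrow> bool" where
  "recursive_game G \<longleftrightarrow> stochastic_game G \<and>
     (\<exists>X0 Xs. X0 \<union> Xs = UNIV \<and> X0 \<inter> Xs = {} \<and>
        (\<forall>x\<in>X0. \<forall>a\<in>actions1 G x. \<forall>b\<in>actions2 G x. payoff G x a b = 0) \<and>
        (\<forall>x\<in>Xs. absorbing_state G x))"

section \<open>Strategies\<close>

text \<open>
  An element \<open>(x\<^sub>1, a\<^sub>1, b\<^sub>1, \<dots>, x\<^sub>t)\<close> of \<open>H\<^sub>t\<close> is given by the list of the \<open>t - 1\<close> past triples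
  together with the current state. As the length of the list determines \<open>t\<close>, one function on
  all such pairs is the same as a sequence \<open>(\<sigma>\<^sub>t)\<close>.
\<close>

type_synonym ('x, 'a, 'b) strategy1 = "('x \<times> 'a \<times> 'b) list \<Rightarrow> 'x \<Rightarrow> 'a pmf"
type_synonym ('x, 'a, 'b) strategy2 = "('x \<times> 'a \<times> 'b) list \<Rightarrow> 'x \<Rightarrow> 'b pmf"

definition strategies1 :: "('x, 'a, 'b) stoch_game \<Rightarrow> ('x, 'a, 'b) strategy1 set" where
  "strategies1 G = {\<sigma>. \<forall>h x. set_pmf (\<sigma> h x) \<subseteq> actions1 G x}"

definition strategies2 :: "('x, 'a, 'b) stoch_game \<Rightarrow> ('x, 'a, 'b) strategy2 set" where
  "strategies2 G = {\<tau>. \<forall>h x. set_pmf (\<tau> h x) \<subseteq> actions2 G x}"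

section \<open>The law of the play\<close>

definition next_state ::
  "('x, 'a, 'b) stoch_game \<Rightarrow> 'x \<Rightarrow> ('x \<times> 'a \<times> 'b) list \<Rightarrow> 'x pmf" where
  "next_state G x1 h =
     (if h = [] then return_pmf x1 else case last h of (x, a, b) \<Rightarrow> trans_prob G x a b)"

definition next_history ::
  "('x, 'a, 'b) stoch_game \<Rightarrow> 'x \<Rightarrow> ('x, 'a, 'b) strategy1 \<Rightarrow> ('x, 'a, 'b) strategy2 \<Rightarrow>
     ('x \<times> 'a \<times> 'b) list \<Rightarrow> ('x \<times> 'a \<times> 'b) list pmf" where
  "next_history G x1 \<sigma> \<tau> h =
     bind_pmf (next_state G x1 h)
       (\<lambda>x. map_pmf (\<lambda>(a, b). h @ [(x, a, b)]) (pair_pmf (\<sigma> h x) (\<tau> h x)))"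

text \<open>
  The measure on plays is obtained from the Ionescu-Tulcea theorem. It is applied to the sequence
  of growing histories and not to the triples \<open>(x\<^sub>t, a\<^sub>t, b\<^sub>t)\<close> themselves: for an uncountable state
  space a strategy need not be measurable for the product of the discrete \<open>\<sigma>\<close>-algebras, whereas
  a kernel that only looks at the last history is.
\<close>

definition history_kernel ::
  "('x, 'a, 'b) stoch_game \<Rightarrow> 'x \<Rightarrow> ('x, 'a, 'b) strategy1 \<Rightarrow> ('x, 'a, 'b) strategy2 \<Rightarrow>
     nat \<Rightarrow> (nat \<Rightarrow> ('x \<times> 'a \<times> 'b) list) \<Rightarrow> ('x \<times> 'a \<times> 'b) list measure" where
  "history_kernel G x1 \<sigma> \<tau> i \<omega> =
     measure_pmf (next_history G x1 \<sigma> \<tau> (if i = 0 then [] else \<omega> (i - 1)))"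

lemma Ionescu_Tulcea_history_kernel:
  "Ionescu_Tulcea (history_kernel G x1 \<sigma> \<tau>) (\<lambda>_. count_space UNIV)"
proof (rule Ionescu_Tulcea.intro)
  fix i
  show "history_kernel G x1 \<sigma> \<tau> i \<in>
      measurable (PiM {0..<i} (\<lambda>_. count_space UNIV)) (subprob_algebra (count_space UNIV))"
  proof (cases i)
    case 0
    then show ?thesis
      by (simp add: history_kernel_def[abs_def] measure_pmf_in_subprob_algebra)
  next
    case (Suc j)
    have "(\<lambda>h. measure_pmf (next_history G x1 \<sigma> \<tau> h)) \<in>
        measurable (count_space UNIV) (subprob_algebra (count_space UNIV))"
      by (simp add: measure_pmf_in_subprob_algebra)
    moreover have "(\<lambda>\<omega>. \<omega> j) \<in>
        measurable (PiM {0..<i} (\<lambda>_. count_space UNIV)) (count_space UNIV)"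
      using Suc by (intro measurable_component_singleton) simp
    ultimately show ?thesis
      using Suc measurable_compose[of "\<lambda>\<omega>. \<omega> j"] by (simp add: history_kernel_def[abs_def])
  qed
qed (simp add: history_kernel_def prob_space_measure_pmf)

definition history_law ::
  "('x, 'a, 'b) stoch_game \<Rightarrow> 'x \<Rightarrow> ('x, 'a, 'b) strategy1 \<Rightarrow> ('x, 'a, 'b) strategy2 \<Rightarrow>
     (nat \<Rightarrow> ('x \<times> 'a \<times> 'b) list) measure" where
  "history_law G x1 \<sigma> \<tau> =
     projective_family.lim UNIV
       (Ionescu_Tulcea.CI (history_kernel G x1 \<sigma> \<tau>) (\<lambda>_. count_space UNIV))
       (\<lambda>_. count_space UNIV)"

text \<open>Plays are indexed from 0: the triple of stage \<open>t \<ge> 1\<close> is \<open>\<omega> (t - 1)\<close>.\<close>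

definition play_law ::
  "('x, 'a, 'b) stoch_game \<Rightarrow> 'x \<Rightarrow> ('x, 'a, 'b) strategy1 \<Rightarrow> ('x, 'a, 'b) strategy2 \<Rightarrow>
     (nat \<Rightarrow> 'x \<times> 'a \<times> 'b) measure" where
  "play_law G x1 \<sigma> \<tau> =
     distr (history_law G x1 \<sigma> \<tau>) (PiM UNIV (\<lambda>_. count_space UNIV)) (\<lambda>\<omega> t. last (\<omega> t))"

lemma prob_space_history_law: "prob_space (history_law G x1 \<sigma> \<tau>)"
proof -
  interpret IT: Ionescu_Tulcea "history_kernel G x1 \<sigma> \<tau>" "\<lambda>_. count_space UNIV"
    by (rule Ionescu_Tulcea_history_kernel)
  let ?E = "\<lambda>x. undefined :: ('a \<times> 'b \<times> 'c) list"
  have X: "{?E} \<in> sets (PiM {} (\<lambda>_. count_space (UNIV :: ('a \<times> 'b \<times> 'c) list set)))"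
    by (simp add: sets_PiM_empty)
  have "emeasure (history_law G x1 \<sigma> \<tau>) (IT.PF.emb UNIV {} {?E}) = emeasure (IT.CI {}) {?E}"
    unfolding history_law_def using X by (rule IT.lim[OF finite.emptyI])
  moreover have "IT.PF.emb UNIV {} {?E} = space (history_law G x1 \<sigma> \<tau>)"
    by (auto simp: history_law_def prod_emb_def space_PiM)
  moreover have "prob_space (IT.CI {})"
    by (rule IT.PF.prob_space_P) simp_all
  ultimately show ?thesis
    using prob_space.emeasure_space_1[of "IT.CI {}"]
    by (intro prob_spaceI) (simp add: space_PiM IT.CI_def)
qed

lemma sets_history_law: "sets (history_law G x1 \<sigma> \<tau>) = sets (PiM UNIV (\<lambda>_. count_space UNIV))"
proof -
  interpret IT: Ionescu_Tulcea "history_kernel G x1 \<sigma> \<tau>" "\<lambda>_. count_space UNIV"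
    by (rule Ionescu_Tulcea_history_kernel)
  show ?thesis
    unfolding history_law_def by (rule IT.PF.sets_lim)
qed

lemma measurable_last_history:
  "(\<lambda>\<omega> t. last (\<omega> t)) \<in>
     measurable (history_law G x1 \<sigma> \<tau>) (PiM UNIV (\<lambda>_. count_space UNIV))"
  unfolding measurable_cong_sets[OF sets_history_law refl]
proof (rule measurable_PiM_single')
  fix t :: nat
  show "(\<lambda>\<omega>. last (\<omega> t)) \<in>
      measurable (PiM UNIV (\<lambda>_. count_space UNIV)) (count_space UNIV)"
    by (rule measurable_compose[where f = "\<lambda>\<omega>. \<omega> t" and N = "count_space UNIV"])
      (auto intro: measurable_component_singleton)
qed simp

lemma prob_space_play_law: "prob_space (play_law G x1 \<sigma> \<tau>)"
  unfolding play_law_def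
  by (rule prob_space.prob_space_distr[OF prob_space_history_law measurable_last_history])

primrec history_pmf ::
  "('x, 'a, 'b) stoch_game \<Rightarrow> 'x \<Rightarrow> ('x, 'a, 'b) strategy1 \<Rightarrow> ('x, 'a, 'b) strategy2 \<Rightarrow>
     nat \<Rightarrow> ('x \<times> 'a \<times> 'b) list pmf" where
  "history_pmf G x1 \<sigma> \<tau> 0 = return_pmf []"
| "history_pmf G x1 \<sigma> \<tau> (Suc n) = bind_pmf (history_pmf G x1 \<sigma> \<tau> n) (next_history G x1 \<sigma> \<tau>)"

lemma pmf_history_snoc:
  "ennreal (pmf (history_pmf G x1 \<sigma> \<tau> (Suc n)) (w @ [z])) =
     ennreal (pmf (history_pmf G x1 \<sigma> \<tau> n) w) * ennreal (pmf (next_history G x1 \<sigma> \<tau> w) (w @ [z]))"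
proof -
  have "ennreal (pmf (next_history G x1 \<sigma> \<tau> h) (w @ [z])) =
      ennreal (pmf (next_history G x1 \<sigma> \<tau> w) (w @ [z])) * indicator {w} h" for h
  proof (cases "h = w")
    case False
    then have "w @ [z] \<notin> set_pmf (next_history G x1 \<sigma> \<tau> h)"
      by (auto simp: next_history_def)
    with False show ?thesis
      by (simp add: set_pmf_iff)
  qed simp
  then have "ennreal (pmf (history_pmf G x1 \<sigma> \<tau> (Suc n)) (w @ [z])) =
      (\<integral>\<^sup>+h. ennreal (pmf (next_history G x1 \<sigma> \<tau> w) (w @ [z])) * indicator {w} h
        \<partial>measure_pmf (history_pmf G x1 \<sigma> \<tau> n))"
    unfolding history_pmf.simps ennreal_pmf_bind by (intro nn_integral_cong)
  also have "\<dots> = ennreal (pmf (next_history G x1 \<sigma> \<tau> w) (w @ [z])) *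
      emeasure (history_pmf G x1 \<sigma> \<tau> n) {w}"
    by (rule nn_integral_cmult_indicator) simp
  finally show ?thesis
    by (simp add: emeasure_pmf_single mult.commute)
qed

lemma emeasure_history_law_cylinder:
  "emeasure (history_law G x1 \<sigma> \<tau>) {\<omega>. \<forall>i<length w. \<omega> i = take (Suc i) w}
     = pmf (history_pmf G x1 \<sigma> \<tau> (length w)) w"
proof -
  interpret IT: Ionescu_Tulcea "history_kernel G x1 \<sigma> \<tau>" "\<lambda>_. count_space UNIV"
    by (rule Ionescu_Tulcea_history_kernel)
  let ?M = "\<lambda>n. PiM {0..<n::nat} (\<lambda>_. count_space (UNIV :: ('a \<times> 'b \<times> 'c) list set))"
  let ?u = "\<lambda>w::('a \<times> 'b \<times> 'c) list. restrict (\<lambda>i. take (Suc i) w) {0..<length w}"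
  have sets_u: "{?u w} \<in> sets (?M (length w))" for w
  proof -
    have "{?u w} = (\<Pi>\<^sub>E i\<in>{0..<length w}. {take (Suc i) w})"
      by (auto simp: PiE_def Pi_def extensional_def fun_eq_iff)
    also have "\<dots> \<in> sets (?M (length w))"
      by (intro sets_PiM_I_finite) auto
    finally show ?thesis .
  qed
  have C: "emeasure (IT.C 0 (length w) (\<lambda>_. undefined)) {?u w}
      = pmf (history_pmf G x1 \<sigma> \<tau> (length w)) w" for w
  proof (induction w rule: rev_induct)
    case Nil
    show ?case
      using sets_u[of "[]"] by (simp add: restrict_def)
  next
    case (snoc z w)
    let ?n = "length w"
    let ?K = "\<lambda>\<omega>. history_kernel G x1 \<sigma> \<tau> ?n \<omega>"
    have sp: "space (IT.C 0 ?n (\<lambda>_. undefined)) = space (?M ?n)"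
      using IT.space_C[of "\<lambda>_. undefined" 0 ?n] by (simp add: space_PiM)
    have u': "{?u (w @ [z])} \<in> sets (?M (Suc ?n))"
      using sets_u[of "w @ [z]"] by simp
    have eq: "emeasure (IT.eP ?n \<omega>) {?u (w @ [z])} =
        ennreal (pmf (next_history G x1 \<sigma> \<tau> w) (w @ [z])) * indicator {?u w} \<omega>"
      if \<omega>: "\<omega> \<in> space (?M ?n)" for \<omega>
    proof -
      have iff: "fun_upd \<omega> ?n y = ?u (w @ [z]) \<longleftrightarrow> y = w @ [z] \<and> \<omega> = ?u w" for y
        using \<omega> by (auto simp: space_PiM PiE_def extensional_def fun_eq_iff restrict_def
            less_Suc_eq split: if_splits)
      have "emeasure (IT.eP ?n \<omega>) {?u (w @ [z])} =
          emeasure (?K \<omega>) (fun_upd \<omega> ?n -` {?u (w @ [z])} \<inter> UNIV)"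
        using IT.emeasure_eP[OF \<omega> u'] by simp
      also have "fun_upd \<omega> ?n -` {?u (w @ [z])} \<inter> UNIV = (if \<omega> = ?u w then {w @ [z]} else {})"
        unfolding set_eq_iff Int_UNIV_right vimage_eq singleton_iff iff by simp
      also have "emeasure (?K \<omega>) \<dots> =
          ennreal (pmf (next_history G x1 \<sigma> \<tau> w) (w @ [z])) * indicator {?u w} \<omega>"
        by (auto simp: history_kernel_def emeasure_pmf_single)
      finally show ?thesis .
    qed
    have "emeasure (IT.C 0 (Suc ?n) (\<lambda>_. undefined)) {?u (w @ [z])} =
        (\<integral>\<^sup>+\<omega>. emeasure (IT.eP ?n \<omega>) {?u (w @ [z])} \<partial>IT.C 0 ?n (\<lambda>_. undefined))"
      unfolding IT.C.simps
      apply (subst emeasure_bind[where N = "?M (Suc ?n)"])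
      using IT.measurable_eP[of ?n] IT.sets_C[of "\<lambda>_. undefined" 0 ?n] u'
      by (auto simp: sp space_PiM_empty_iff space_PiM PiE_eq_empty_iff
          measurable_cong_sets[of "IT.C 0 ?n (\<lambda>_. undefined)" "?M ?n"])
    also have "\<dots> = (\<integral>\<^sup>+\<omega>. ennreal (pmf (next_history G x1 \<sigma> \<tau> w) (w @ [z])) * indicator {?u w} \<omega>
        \<partial>IT.C 0 ?n (\<lambda>_. undefined))"
      by (intro nn_integral_cong eq) (simp only: sp)
    also have "\<dots> = ennreal (pmf (next_history G x1 \<sigma> \<tau> w) (w @ [z])) *
        emeasure (IT.C 0 ?n (\<lambda>_. undefined)) {?u w}"
      using sets_u[of w] IT.sets_C[of "\<lambda>_. undefined" 0 ?n]
      by (intro nn_integral_cmult_indicator) (simp add: space_PiM)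
    finally show ?case
      by (simp only: length_append_singleton snoc.IH pmf_history_snoc mult.commute)
  qed
  have "{\<omega>. \<forall>i<length w. \<omega> i = take (Suc i) w} = IT.PF.emb UNIV {0..<length w} {?u w}"
    by (auto simp: prod_emb_def space_PiM restrict_def fun_eq_iff) metis
  then have "emeasure (history_law G x1 \<sigma> \<tau>) {\<omega>. \<forall>i<length w. \<omega> i = take (Suc i) w} =
      emeasure (IT.CI {0..<length w}) {?u w}"
    unfolding history_law_def using IT.lim[OF _ sets_u[of w]] by simp
  also have "\<dots> = emeasure (IT.C 0 (length w) (\<lambda>_. undefined)) {?u w}"
    using IT.emeasure_CI[OF subset_refl sets_u[of w]] sets.sets_into_space[OF sets_u[of w]]
    by (simp add: prod_emb_id space_PiM)
  finally show ?thesis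
    by (simp add: C)
qed

text \<open>
  The initial segments of a play have the intended law. Since \<^term>\<open>history_pmf G x1 \<sigma> \<tau> n\<close> is
  discrete, these cylinders carry all the mass and so determine the measure on plays.
\<close>

lemma emeasure_play_law_cylinder:
  "emeasure (play_law G x1 \<sigma> \<tau>) {\<omega>. map \<omega> [0..<length w] = w}
     = pmf (history_pmf G x1 \<sigma> \<tau> (length w)) w"
proof -
  let ?Q = "play_law G x1 \<sigma> \<tau>" and ?n = "length w"
  let ?H = "history_pmf G x1 \<sigma> \<tau> ?n"
  let ?cyl = "\<lambda>w. {\<omega>. map \<omega> [0..<length w] = w}"
  interpret Q: prob_space ?Q
    by (rule prob_space_play_law)
  have sets_Q: "sets ?Q = sets (PiM UNIV (\<lambda>_. count_space UNIV))"
    by (simp add: play_law_def)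
  then have space_Q: "space ?Q = UNIV"
    using sets_eq_imp_space_eq[OF sets_Q] by (simp add: space_PiM)
  have cyl_eq: "?cyl w = {\<omega>. \<forall>i<length w. \<omega> i = w ! i}" for w :: "('a \<times> 'b \<times> 'c) list"
    unfolding list_eq_iff_nth_eq[of "map _ _"] by simp
  have cyl[simp]: "?cyl w \<in> sets ?Q" for w
  proof -
    have "?cyl w = prod_emb UNIV (\<lambda>_. count_space UNIV) {0..<length w} (\<Pi>\<^sub>E i\<in>{0..<length w}. {w ! i})"
      unfolding cyl_eq by (auto simp: prod_emb_def space_PiM PiE_def Pi_def)
    also have "\<dots> \<in> sets ?Q"
      unfolding sets_Q by (intro sets_PiM_I) auto
    finally show ?thesis .
  qed
  have lower: "ennreal (pmf (history_pmf G x1 \<sigma> \<tau> (length w)) w) \<le> emeasure ?Q (?cyl w)" for w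
  proof -
    have "ennreal (pmf (history_pmf G x1 \<sigma> \<tau> (length w)) w) =
        emeasure (history_law G x1 \<sigma> \<tau>) {\<omega>. \<forall>i<length w. \<omega> i = take (Suc i) w}"
      by (rule emeasure_history_law_cylinder[symmetric])
    also have "\<dots> \<le> emeasure (history_law G x1 \<sigma> \<tau>)
        ((\<lambda>\<omega> t. last (\<omega> t)) -` ?cyl w \<inter> space (history_law G x1 \<sigma> \<tau>))"
    proof (rule emeasure_mono)
      have "space (history_law G x1 \<sigma> \<tau>) = UNIV"
        using sets_eq_imp_space_eq[OF sets_history_law] by (simp add: space_PiM)
      then show "{\<omega>. \<forall>i<length w. \<omega> i = take (Suc i) w} \<subseteq>
          (\<lambda>\<omega> t. last (\<omega> t)) -` ?cyl w \<inter> space (history_law G x1 \<sigma> \<tau>)"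
        unfolding cyl_eq by (auto simp: take_Suc_conv_app_nth)
      show "(\<lambda>\<omega> t. last (\<omega> t)) -` ?cyl w \<inter> space (history_law G x1 \<sigma> \<tau>)
          \<in> sets (history_law G x1 \<sigma> \<tau>)"
        using cyl[of w] unfolding sets_Q by (rule measurable_sets[OF measurable_last_history])
    qed
    also have "\<dots> = emeasure ?Q (?cyl w)"
      using cyl[of w] unfolding sets_Q play_law_def
      by (subst emeasure_distr[OF measurable_last_history]) auto
    finally show ?thesis .
  qed
  have len: "length h = n" if "h \<in> set_pmf (history_pmf G x1 \<sigma> \<tau> n)" for h n
    using that by (induction n arbitrary: h) (auto simp: next_history_def)
  let ?K = "set_pmf ?H - {w}"
  have K: "(\<Union>h\<in>?K. ?cyl h) \<subseteq> space ?Q - ?cyl w"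
    using len by (auto simp: space_Q)
  have "emeasure ?H (- {w}) = (\<integral>\<^sup>+h. ennreal (pmf ?H h) \<partial>count_space (- {w}))"
    by (simp add: nn_integral_pmf)
  also have "\<dots> = (\<integral>\<^sup>+h. ennreal (pmf ?H h) \<partial>count_space ?K)"
    by (rule nn_integral_count_space_eq) (auto simp: set_pmf_iff)
  also have "\<dots> \<le> (\<integral>\<^sup>+h. emeasure ?Q (?cyl h) \<partial>count_space ?K)"
    using lower len by (intro nn_integral_mono) (metis DiffD1 space_count_space)
  also have "\<dots> = emeasure ?Q (\<Union>h\<in>?K. ?cyl h)"
    using len by (intro emeasure_UN_countable[symmetric]) (auto simp: disjoint_family_on_def)
  also have "\<dots> \<le> emeasure ?Q (space ?Q - ?cyl w)"
    by (intro emeasure_mono K) auto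
  finally have "1 - pmf ?H w \<le> 1 - measure ?Q (?cyl w)"
    using measure_pmf.prob_compl[of "{w}" ?H] Q.prob_compl[OF cyl[of w]]
    by (simp add: measure_pmf.emeasure_eq_measure Q.emeasure_eq_measure Compl_eq_Diff_UNIV measure_pmf_single)
  moreover have "pmf ?H w \<le> measure ?Q (?cyl w)"
    using lower[of w] by (simp add: Q.emeasure_eq_measure)
  ultimately show ?thesis
    by (simp add: Q.emeasure_eq_measure)
qed

section \<open>Payoffs and values\<close>

definition stage_payoff ::
  "('x, 'a, 'b) stoch_game \<Rightarrow> (nat \<Rightarrow> 'x \<times> 'a \<times> 'b) \<Rightarrow> nat \<Rightarrow> real" where
  "stage_payoff G \<omega> t = (case \<omega> t of (x, a, b) \<Rightarrow> payoff G x a b)"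

definition payoff_n ::
  "('x, 'a, 'b) stoch_game \<Rightarrow> nat \<Rightarrow> 'x \<Rightarrow> ('x, 'a, 'b) strategy1 \<Rightarrow> ('x, 'a, 'b) strategy2 \<Rightarrow> real"
  where
  "payoff_n G n x1 \<sigma> \<tau> =
     (\<integral>\<omega>. (1 / real n) * (\<Sum>t<n. stage_payoff G \<omega> t) \<partial>play_law G x1 \<sigma> \<tau>)"

definition payoff_disc ::
  "('x, 'a, 'b) stoch_game \<Rightarrow> real \<Rightarrow> 'x \<Rightarrow> ('x, 'a, 'b) strategy1 \<Rightarrow> ('x, 'a, 'b) strategy2 \<Rightarrow> real"
  where
  "payoff_disc G l x1 \<sigma> \<tau> =
     (\<integral>\<omega>. l * (\<Sum>t. (1 - l) ^ t * stage_payoff G \<omega> t) \<partial>play_law G x1 \<sigma> \<tau>)"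

text \<open>
  Both iterated bounds below are bounds of bounded nonempty sets for the payoffs above, so the
  operators on \<^typ>\<open>real\<close> are the usual ones.
\<close>

definition has_value :: "'s set \<Rightarrow> 't set \<Rightarrow> ('s \<Rightarrow> 't \<Rightarrow> real) \<Rightarrow> real \<Rightarrow> bool" where
  "has_value S T f v \<longleftrightarrow>
     (SUP \<sigma>\<in>S. INF \<tau>\<in>T. f \<sigma> \<tau>) = v \<and> (INF \<tau>\<in>T. SUP \<sigma>\<in>S. f \<sigma> \<tau>) = v"

definition game_value :: "'s set \<Rightarrow> 't set \<Rightarrow> ('s \<Rightarrow> 't \<Rightarrow> real) \<Rightarrow> real" where
  "game_value S T f = (THE v. has_value S T f v)"

definition value_n :: "('x, 'a, 'b) stoch_game \<Rightarrow> nat \<Rightarrow> 'x \<Rightarrow> real" where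
  "value_n G n x1 = game_value (strategies1 G) (strategies2 G) (payoff_n G n x1)"

definition value_disc :: "('x, 'a, 'b) stoch_game \<Rightarrow> real \<Rightarrow> 'x \<Rightarrow> real" where
  "value_disc G l x1 = game_value (strategies1 G) (strategies2 G) (payoff_disc G l x1)"

end

theory Submission
  imports Defs
begin

text \<open>
  The values of both families come from one operator, the Shapley operator \<open>T\<close>: for a weight \<open>s\<close> and a
  function \<open>f\<close> on states, \<open>T s f x\<close> is the value of the matrix game at \<open>x\<close> with payoffs
  \<open>s * g(x, a, b) + E f\<close>, where the expectation is over the next state. Dynamic programming gives
  \<open>n * v_n = T 1 (\<dots> (T 1 0))\<close> with \<open>n\<close> applications, and \<open>v_l\<close> is the fixed point of the contraction
  \<open>f \<mapsto> T l ((1 - l) f)\<close> (\<open>value_n_eq\<close>, \<open>value_disc_eq\<close>). Both facts rest on the minimax theorem for finite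
  matrix games (\<open>minimax\<close>): players who play optimally in the local games guarantee these numbers,
  so the games on plays have a value.

  The operator satisfies \<open>|T s f - T t g| \<le> |s - t| + sup |f - g|\<close>, because \<open>|g| \<le> 1\<close>, and
  \<open>T (c s) (c f) = c T s f\<close> for \<open>c \<ge> 0\<close>. These two properties suffice, following an idea of Ziliotto.
  Consider a block of \<open>p\<close> stages of weight \<open>l\<close> each, with \<open>p * l\<close> close to a small number \<open>d\<close>. Discounting
  changes the weights within the block, and the weight of the future after it, by \<open>O(d\<^sup>2)\<close> in total
  (\<open>discounted_block\<close>). So over one block \<open>v_l\<close> with \<open>l = 1 / n\<close> and \<open>v_n\<close> satisfy the same recursion up
  to \<open>O(d\<^sup>2)\<close>, while the block carries the weight \<open>d\<close>; an approximate solution of one recursion is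
  therefore within \<open>O(d\<^sup>2) / d = O(d)\<close> of the solution of the other. In one direction the error is
  summed over about \<open>log n / d\<close> blocks of geometrically decreasing length (\<open>mean_values_converge\<close>), in
  the other one the block is a contraction with factor \<open>1 - O(d)\<close>
  (\<open>discounted_values_converge\<close>). All bounds are uniform in the state. Letting \<open>d\<close> tend to \<open>0\<close> shows that
  a uniform limit of either family is one of the other.
\<close>

section \<open>Values of finite matrix games\<close>

lemma finite_sets_strictly_separated:
  fixes L U :: "real set"
  assumes "finite L" "finite U" "\<And>l u. l \<in> L \<Longrightarrow> u \<in> U \<Longrightarrow> l < u"
  shows "\<exists>t. (\<forall>l\<in>L. l < t) \<and> (\<forall>u\<in>U. t < u)"
proof (cases "L = {} \<or> U = {}")
  case True
  then show ?thesis
  proof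
    assume "L = {}"
    moreover have "Min (insert 0 U) - 1 < u" if "u \<in> U" for u
    proof -
      have "Min (insert 0 U) \<le> u"
        using that assms(2) by (intro Min_le) auto
      then show ?thesis by linarith
    qed
    ultimately show ?thesis
      by blast
  next
    assume "U = {}"
    moreover have "l < Max (insert 0 L) + 1" if "l \<in> L" for l
    proof -
      have "l \<le> Max (insert 0 L)"
        using that assms(1) by (intro Max_ge) auto
      then show ?thesis by linarith
    qed
    ultimately show ?thesis
      by blast
  qed
next
  case False
  then have "Max L < Min U"
    using assms by simp
  then obtain t where "Max L < t" "t < Min U"
    using dense by blast
  then show ?thesis
    using False assms by auto
qed

text \<open>
  A theorem of the alternative in the style of Ville and Gordan, proved without topology by
  Fourier-Motzkin elimination: to eliminate the coordinate \<open>b0\<close>, keep the vectors that are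
  nonnegative there and replace each pair of opposite signs by the positive combination that
  vanishes there. The set \<open>C\<close> is what makes the induction work: intersecting it with the half space
  \<open>f b0 \<ge> 0\<close> remembers the coordinates that were already eliminated.
\<close>

lemma positive_combination_alternative:
  fixes C F :: "('b \<Rightarrow> real) set"
  assumes "finite B" "finite F" "F \<noteq> {}" "F \<subseteq> C"
    and "\<And>f g s t. f \<in> C \<Longrightarrow> g \<in> C \<Longrightarrow> 0 \<le> s \<Longrightarrow> 0 \<le> t \<Longrightarrow> 0 < s + t \<Longrightarrow> (\<lambda>b. s * f b + t * g b) \<in> C"
  shows "(\<exists>f\<in>C. \<forall>b\<in>B. 0 \<le> f b) \<or>
    (\<exists>q. (\<forall>b\<in>B. 0 \<le> q b) \<and> (\<forall>f\<in>F. (\<Sum>b\<in>B. q b * f b) < 0))"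
  using assms
proof (induction B arbitrary: C F rule: finite_induct)
  case empty
  then show ?case by auto
next
  case (insert b0 B)
  define K where "K = {f \<in> C. 0 \<le> f b0}"
  define P where "P = {f \<in> F. 0 < f b0}"
  define N where "N = {f \<in> F. f b0 < 0}"
  define mix where "mix = (\<lambda>(f, g). \<lambda>b. (- g b0) * f b + f b0 * g b :: real)"
  define F' where "F' = {f \<in> F. 0 \<le> f b0} \<union> mix ` (P \<times> N)"
  have fin: "finite P" "finite N" "finite F'"
    using insert.prems by (auto simp: P_def N_def F'_def)
  show ?case
  proof (cases "F' = {}")
    case True
    (* Every vector is negative at the coordinate b0, so all the weight may be put there. *)
    then have "f b0 < 0" if "f \<in> F" for f
      using that by (force simp: F'_def)
    moreover have "(\<Sum>b\<in>insert b0 B. (if b = b0 then 1 else 0) * f b) = f b0" for f :: "'b \<Rightarrow> real"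
      using insert.hyps by (simp add: if_distrib[of "\<lambda>x. x * _"] cong: if_cong)
    ultimately show ?thesis
      by (intro disjI2 exI[of _ "\<lambda>b. if b = b0 then 1 else 0"]) auto
  next
    case False
    have F'K: "F' \<subseteq> K"
    proof -
      have "mix (f, g) \<in> K" if "f \<in> P" "g \<in> N" for f g
        using that insert.prems(3) insert.prems(4)[of f g "- g b0" "f b0"]
        by (auto simp: K_def P_def N_def mix_def)
      then show ?thesis
        using insert.prems(3) by (auto simp: F'_def K_def)
    qed
    have K: "(\<lambda>b. s * f b + t * g b) \<in> K"
      if "f \<in> K" "g \<in> K" "0 \<le> s" "0 \<le> t" "0 < s + t" for f g s t
      using that insert.prems(4)[of f g s t] by (auto simp: K_def)
    from insert.IH[OF fin(3) False F'K K]
    show ?thesis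
    proof
      assume "\<exists>f\<in>K. \<forall>b\<in>B. 0 \<le> f b"
      then show ?thesis
        by (auto simp: K_def)
    next
      assume "\<exists>q. (\<forall>b\<in>B. 0 \<le> q b) \<and> (\<forall>f\<in>F'. (\<Sum>b\<in>B. q b * f b) < 0)"
      then obtain q where q: "\<And>b. b \<in> B \<Longrightarrow> 0 \<le> q b"
        and neg: "\<And>f. f \<in> F' \<Longrightarrow> (\<Sum>b\<in>B. q b * f b) < 0"
        by blast
      define S where "S = (\<lambda>f. \<Sum>b\<in>B. q b * f b)"
      have S_mix: "S (mix (f, g)) = (- g b0) * S f + f b0 * S g" for f g
        by (simp add: S_def mix_def sum_distrib_left ring_distribs sum_subtractf mult_ac sum_negf)
      have S_P: "S f < 0" if "f \<in> P" for f
        using that neg by (auto simp: S_def P_def F'_def)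
      (* The weight t of b0 must exceed the bounds that come from N and stay below those from P.
         Each lower bound is below each upper bound because q is negative on the mixture of the pair. *)
      have ex: "\<exists>t. (\<forall>l\<in>insert 0 ((\<lambda>g. S g / (- g b0)) ` N). l < t) \<and>
          (\<forall>u\<in>(\<lambda>f. (- S f) / f b0) ` P. t < u)"
      proof (rule finite_sets_strictly_separated)
        fix l u
        assume l: "l \<in> insert 0 ((\<lambda>g. S g / (- g b0)) ` N)" and "u \<in> (\<lambda>f. (- S f) / f b0) ` P"
        then obtain f where f: "f \<in> P" "u = (- S f) / f b0"
          by auto
        have "0 < u"
          using f S_P by (simp add: P_def divide_neg_pos)
        moreover have "S g / (- g b0) < u" if "g \<in> N" for g
        proof -
          have "S (mix (f, g)) < 0"
            using f that neg by (auto simp: S_def F'_def)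
          then have "S g < ((- S f) * (- g b0)) / f b0"
            using f that by (simp add: S_mix P_def pos_less_divide_eq mult.commute)
          then show ?thesis
            unfolding f(2) using that by (subst pos_divide_less_eq) (auto simp: N_def)
        qed
        ultimately show "l < u"
          using l by auto
      qed (use fin in auto)
      then obtain t where sep: "\<forall>l\<in>insert 0 ((\<lambda>g. S g / (- g b0)) ` N). l < t"
          "\<forall>u\<in>(\<lambda>f. (- S f) / f b0) ` P. t < u"
        by blast
      have t: "0 < t" "\<And>g. g \<in> N \<Longrightarrow> S g / (- g b0) < t" "\<And>f. f \<in> P \<Longrightarrow> t < (- S f) / f b0"
        using sep by blast+
      have "S f + t * f b0 < 0" if "f \<in> F" for f
      proof -
        have "f \<in> P \<or> f \<in> N \<or> f b0 = 0 \<and> f \<in> F'"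
          using that less_linear[of "f b0" 0] by (auto simp: P_def N_def F'_def)
        then consider "f \<in> P" | "f \<in> N" | "f b0 = 0" "f \<in> F'"
          by blast
        then show ?thesis
        proof cases
          case 1
          then have "0 < f b0" "t < (- S f) / f b0"
            using t(3) by (auto simp: P_def)
          then show ?thesis
            by (subst (asm) pos_less_divide_eq) auto
        next
          case 2
          then have "0 < - f b0" "S f / (- f b0) < t"
            using t(2) by (auto simp: N_def)
          then show ?thesis
            by (subst (asm) pos_divide_less_eq) auto
        next
          case 3
          with neg show ?thesis by (simp add: S_def)
        qed
      qed
      moreover have "(\<Sum>b\<in>insert b0 B. (q(b0 := t)) b * f b) = S f + t * f b0" for f
        using insert.hyps by (auto simp: S_def intro!: sum.cong)
      ultimately show ?thesis
        using q t(1) by (intro disjI2 exI[of _ "q(b0 := t)"]) auto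
    qed
  qed
qed

lemma expectation_eq_sum:
  fixes f :: "'a \<Rightarrow> real"
  assumes "finite A" "set_pmf p \<subseteq> A"
  shows "measure_pmf.expectation p f = (\<Sum>a\<in>A. pmf p a * f a)"
  using assms by (subst integral_measure_pmf_real[of A]) (auto simp: mult.commute)

lemma expectation_mono:
  fixes f g :: "'a \<Rightarrow> real"
  assumes "finite (set_pmf p)" "\<And>a. a \<in> set_pmf p \<Longrightarrow> f a \<le> g a"
  shows "measure_pmf.expectation p f \<le> measure_pmf.expectation p g"
  using assms by (intro integral_mono_AE) (auto simp: AE_measure_pmf_iff integrable_measure_pmf_finite)

lemma expectation_add:
  fixes f g :: "'a \<Rightarrow> real"
  assumes "finite (set_pmf p)"
  shows "measure_pmf.expectation p (\<lambda>a. f a + g a) =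
    measure_pmf.expectation p f + measure_pmf.expectation p g"
  using assms by (simp add: integrable_measure_pmf_finite)

lemma expectation_swap:
  fixes M :: "'a \<Rightarrow> 'b \<Rightarrow> real"
  assumes "finite (set_pmf p)" "finite (set_pmf q)"
  shows "measure_pmf.expectation p (\<lambda>a. measure_pmf.expectation q (\<lambda>b. M a b)) =
    measure_pmf.expectation q (\<lambda>b. measure_pmf.expectation p (\<lambda>a. M a b))"
  by (simp add: expectation_eq_sum[OF assms(1) order_refl] expectation_eq_sum[OF assms(2) order_refl]
      sum_distrib_left sum.swap[of _ "set_pmf q"] mult.left_commute)

lemma expectation_abs_le:
  fixes f :: "'a \<Rightarrow> real"
  assumes "finite (set_pmf p)" "\<And>a. a \<in> set_pmf p \<Longrightarrow> \<bar>f a\<bar> \<le> c"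
  shows "\<bar>measure_pmf.expectation p f\<bar> \<le> c"
proof -
  have "measure_pmf.expectation p (\<lambda>_. - c) \<le> measure_pmf.expectation p f"
    "measure_pmf.expectation p f \<le> measure_pmf.expectation p (\<lambda>_. c)"
    using assms by (intro expectation_mono; force simp: abs_le_iff)+
  then show ?thesis by simp
qed

lemma expectation_bind:
  fixes h :: "'b \<Rightarrow> real"
  assumes "finite (set_pmf p)" "\<And>x. x \<in> set_pmf p \<Longrightarrow> finite (set_pmf (f x))"
  shows "measure_pmf.expectation (bind_pmf p f) h =
    measure_pmf.expectation p (\<lambda>x. measure_pmf.expectation (f x) h)"
  using assms by (subst pmf_expectation_bind[of "set_pmf p"])
    (auto simp: expectation_eq_sum[OF assms(1) order_refl])

lemma expectation_pair:
  fixes M :: "'a \<Rightarrow> 'b \<Rightarrow> real"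
  assumes "finite (set_pmf p)" "finite (set_pmf q)"
  shows "measure_pmf.expectation (pair_pmf p q) (\<lambda>(a, b). M a b) =
    measure_pmf.expectation p (\<lambda>a. measure_pmf.expectation q (\<lambda>b. M a b))"
  using assms by (simp add: pair_pmf_def expectation_bind)

text \<open>
  The alternative produces unnormalized weights, strategies are probabilities.
\<close>

lemma pmf_of_weights:
  fixes w :: "'a \<Rightarrow> real"
  assumes A: "finite A" and w: "\<And>a. a \<in> A \<Longrightarrow> 0 \<le> w a" "0 < sum w A"
  obtains p where "set_pmf p \<subseteq> A"
    "\<And>f :: 'a \<Rightarrow> real. measure_pmf.expectation p f = (\<Sum>a\<in>A. w a * f a) / sum w A"
proof -
  define u where "u = (\<lambda>a. if a \<in> A then w a / sum w A else 0)"
  have "(\<integral>\<^sup>+a. ennreal (u a) \<partial>count_space UNIV) = (\<integral>\<^sup>+a. ennreal (u a) \<partial>count_space A)"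
    by (rule nn_integral_count_space_eq) (auto simp: u_def)
  also have "\<dots> = ennreal (\<Sum>a\<in>A. u a)"
    using A w by (subst nn_integral_count_space_finite) (auto simp: u_def intro!: sum_ennreal)
  also have "(\<Sum>a\<in>A. u a) = 1"
    using w by (simp add: u_def flip: sum_divide_distrib)
  finally have pmf: "pmf (embed_pmf u) a = u a" for a
    using w by (intro pmf_embed_pmf) (auto simp: u_def)
  have sub: "set_pmf (embed_pmf u) \<subseteq> A"
    using pmf by (auto simp: set_pmf_iff u_def split: if_splits)
  have "measure_pmf.expectation (embed_pmf u) f = (\<Sum>a\<in>A. w a * f a) / sum w A" for f :: "'a \<Rightarrow> real"
    unfolding expectation_eq_sum[OF A sub] pmf sum_divide_distrib
    by (intro sum.cong) (auto simp: u_def)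
  with sub show thesis
    by (rule that)
qed

text \<open>
  Subtracting \<open>v\<close> from all entries reduces the claim to the case \<open>v = 0\<close>, where
  \<open>positive_combination_alternative\<close> applies to the rows of the matrix and the cone that they span.
\<close>

lemma matrix_game_alternative:
  fixes M :: "'a \<Rightarrow> 'b \<Rightarrow> real"
  assumes A: "finite A" "A \<noteq> {}" and B: "finite B"
  shows "(\<exists>p. set_pmf p \<subseteq> A \<and> (\<forall>b\<in>B. v \<le> measure_pmf.expectation p (\<lambda>a. M a b))) \<or>
    (\<exists>q. set_pmf q \<subseteq> B \<and> (\<forall>a\<in>A. measure_pmf.expectation q (M a) < v))"
proof -
  define comb where "comb w = (\<lambda>b. \<Sum>a\<in>A. w a * (M a b - v))" for w :: "'a \<Rightarrow> real"
  define W where "W = {w :: 'a \<Rightarrow> real. (\<forall>a\<in>A. 0 \<le> w a) \<and> 0 < sum w A}"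
  have "(\<exists>f\<in>comb ` W. \<forall>b\<in>B. 0 \<le> f b) \<or>
    (\<exists>q. (\<forall>b\<in>B. 0 \<le> q b) \<and> (\<forall>f\<in>(\<lambda>a b. M a b - v) ` A. (\<Sum>b\<in>B. q b * f b) < 0))"
  proof (rule positive_combination_alternative[OF B])
    show "(\<lambda>a b. M a b - v) ` A \<subseteq> comb ` W"
    proof (rule image_subsetI)
      fix a assume a: "a \<in> A"
      then have "(\<lambda>a'. if a' = a then 1 else 0) \<in> W"
        "comb (\<lambda>a'. if a' = a then 1 else 0) = (\<lambda>b. M a b - v)"
        using A by (auto simp: W_def comb_def if_distrib[of "\<lambda>x. x * _"] cong: if_cong)
      then show "(\<lambda>b. M a b - v) \<in> comb ` W"
        by (intro image_eqI[where f = comb]) auto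
    qed
  next
    fix f g :: "'b \<Rightarrow> real" and s t :: real
    assume "f \<in> comb ` W" "g \<in> comb ` W" and st: "0 \<le> s" "0 \<le> t" "0 < s + t"
    then obtain w w' where w: "w \<in> W" "f = comb w" "w' \<in> W" "g = comb w'"
      by blast
    have "sum (\<lambda>a. s * w a + t * w' a) A = s * sum w A + t * sum w' A"
      by (simp add: sum.distrib sum_distrib_left)
    moreover have "0 < s * sum w A + t * sum w' A"
      using w st by (cases "s = 0") (auto simp: W_def add_pos_nonneg)
    ultimately have "(\<lambda>a. s * w a + t * w' a) \<in> W"
      using w st by (auto simp: W_def)
    moreover have "comb (\<lambda>a. s * w a + t * w' a) = (\<lambda>b. s * f b + t * g b)"
      by (simp add: w comb_def fun_eq_iff sum_distrib_left ring_distribs mult_ac flip: sum.distrib)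
    ultimately show "(\<lambda>b. s * f b + t * g b) \<in> comb ` W"
      by (intro image_eqI[where f = comb]) auto
  qed (use A in auto)
  then show ?thesis
  proof
    assume "\<exists>f\<in>comb ` W. \<forall>b\<in>B. 0 \<le> f b"
    then obtain w where w: "w \<in> W" "\<And>b. b \<in> B \<Longrightarrow> 0 \<le> comb w b"
      by auto
    then have pos: "0 < sum w A"
      by (simp add: W_def)
    obtain p where p: "set_pmf p \<subseteq> A"
      "\<And>f :: 'a \<Rightarrow> real. measure_pmf.expectation p f = (\<Sum>a\<in>A. w a * f a) / sum w A"
      using pmf_of_weights[of A w] A(1) w(1) by (auto simp: W_def)
    have "v \<le> measure_pmf.expectation p (\<lambda>a. M a b)" if "b \<in> B" for b
    proof -
      have "0 \<le> (\<Sum>a\<in>A. w a * M a b) - v * sum w A"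
        using w(2)[OF that] by (simp add: comb_def algebra_simps sum_subtractf sum_distrib_left)
      then show ?thesis
        using pos by (simp add: p(2) field_simps)
    qed
    with p(1) show ?thesis by blast
  next
    assume "\<exists>q. (\<forall>b\<in>B. 0 \<le> q b) \<and> (\<forall>f\<in>(\<lambda>a b. M a b - v) ` A. (\<Sum>b\<in>B. q b * f b) < 0)"
    then obtain w where w: "\<And>b. b \<in> B \<Longrightarrow> 0 \<le> w b"
      "\<And>a. a \<in> A \<Longrightarrow> (\<Sum>b\<in>B. w b * (M a b - v)) < 0"
      by auto
    (* The strict inequality for some row excludes that all weights vanish. *)
    have pos: "0 < sum w B"
    proof (rule ccontr)
      assume "\<not> 0 < sum w B"
      then have "sum w B = 0"
        using sum_nonneg[of B w] w(1) by fastforce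
      then have "\<forall>b\<in>B. w b = 0"
        using B w(1) by (simp add: sum_nonneg_eq_0_iff)
      then show False
        using w(2) A by fastforce
    qed
    obtain q where q: "set_pmf q \<subseteq> B"
      "\<And>f :: 'b \<Rightarrow> real. measure_pmf.expectation q f = (\<Sum>b\<in>B. w b * f b) / sum w B"
      using pmf_of_weights[of B w] B w(1) pos by auto
    have "measure_pmf.expectation q (M a) < v" if "a \<in> A" for a
    proof -
      have "(\<Sum>b\<in>B. w b * M a b) - v * sum w B < 0"
        using w(2)[OF that] by (simp add: algebra_simps sum_subtractf sum_distrib_left)
      then show ?thesis
        using pos by (simp add: q(2) field_simps)
    qed
    with q(1) show ?thesis by blast
  qed
qed

definition saddle :: "'a set \<Rightarrow> 'b set \<Rightarrow> ('a \<Rightarrow> 'b \<Rightarrow> real) \<Rightarrow> real \<Rightarrow> 'a pmf \<Rightarrow> 'b pmf \<Rightarrow> bool" where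
  "saddle A B M v p q \<longleftrightarrow> set_pmf p \<subseteq> A \<and> set_pmf q \<subseteq> B \<and>
     (\<forall>b\<in>B. v \<le> measure_pmf.expectation p (\<lambda>a. M a b)) \<and>
     (\<forall>a\<in>A. measure_pmf.expectation q (M a) \<le> v)"

text \<open>
  Both players' guarantees bound the same bilinear payoff. The error term \<open>e\<close> makes the lemma serve
  twice: with \<open>e = 0\<close> for weak duality and uniqueness of the value, and with \<open>e > 0\<close> for the
  continuity of the value in the matrix.
\<close>

lemma guarantee_le_guarantee:
  fixes M :: "'a \<Rightarrow> 'b \<Rightarrow> real"
  assumes fin: "finite A" "finite B" and sub: "set_pmf p \<subseteq> A" "set_pmf q \<subseteq> B"
    and p: "\<And>b. b \<in> B \<Longrightarrow> v \<le> measure_pmf.expectation p (\<lambda>a. M a b)"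
    and q: "\<And>a. a \<in> A \<Longrightarrow> measure_pmf.expectation q (N a) \<le> u"
    and le: "\<And>a b. a \<in> A \<Longrightarrow> b \<in> B \<Longrightarrow> M a b \<le> N a b + e"
  shows "v \<le> u + e"
proof -
  have finp: "finite (set_pmf p)" "finite (set_pmf q)"
    using fin sub finite_subset by auto
  have "measure_pmf.expectation q (\<lambda>_. v) \<le>
      measure_pmf.expectation q (\<lambda>b. measure_pmf.expectation p (\<lambda>a. M a b))"
    using finp sub p by (intro expectation_mono) auto
  also have "\<dots> = measure_pmf.expectation p (\<lambda>a. measure_pmf.expectation q (\<lambda>b. M a b))"
    by (rule expectation_swap[OF finp, symmetric])
  also have "\<dots> \<le> measure_pmf.expectation p (\<lambda>a. measure_pmf.expectation q (\<lambda>b. N a b + e))"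
    using finp sub le by (intro expectation_mono) auto
  also have "\<dots> \<le> measure_pmf.expectation p (\<lambda>_. u + e)"
    using finp sub q by (intro expectation_mono) (auto simp: expectation_add)
  finally show ?thesis by simp
qed

text \<open>
  Let \<open>v\<close> be the supremum of the levels that player 1 can guarantee. Player 2 has no strategy that
  stays strictly below \<open>v\<close> against every row, so by the alternative player 1 attains \<open>v\<close>. Player 1
  has no strategy that stays strictly above \<open>v\<close>, so the alternative for the transposed game gives
  player 2 a strategy that attains \<open>v\<close>. As there are finitely many actions, "strictly for each
  action" and "strictly and uniformly" coincide, which replaces the usual compactness argument.
\<close>

lemma minimax:
  fixes M :: "'a \<Rightarrow> 'b \<Rightarrow> real"
  assumes A: "finite A" "A \<noteq> {}" and B: "finite B" "B \<noteq> {}"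
  shows "\<exists>v p q. saddle A B M v p q"
proof -
  define V where "V = {v. \<exists>p. set_pmf p \<subseteq> A \<and> (\<forall>b\<in>B. v \<le> measure_pmf.expectation p (\<lambda>a. M a b))}"
  have V_le: "v \<le> u"
    if v: "v \<in> V" and q: "set_pmf q \<subseteq> B" "\<And>a. a \<in> A \<Longrightarrow> measure_pmf.expectation q (M a) \<le> u" for v u q
  proof -
    obtain p where "set_pmf p \<subseteq> A" "\<forall>b\<in>B. v \<le> measure_pmf.expectation p (\<lambda>a. M a b)"
      using v by (auto simp: V_def)
    then show ?thesis
      using guarantee_le_guarantee[OF A(1) B(1) _ q(1), of p v M M u 0] q(2) by auto
  qed
  obtain a0 b0 where a0: "a0 \<in> A" and b0: "b0 \<in> B"
    using A B by blast
  have ne: "V \<noteq> {}"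
  proof -
    have "Min ((\<lambda>b. M a0 b) ` B) \<in> V"
      using a0 B by (auto simp: V_def intro!: exI[of _ "return_pmf a0"])
    then show ?thesis by blast
  qed
  have bdd: "bdd_above V"
    by (rule bdd_aboveI[of _ "Max ((\<lambda>a. M a b0) ` A)"], rule V_le[of _ "return_pmf b0"])
      (use b0 A in auto)
  let ?v = "Sup V"
  have "\<not> (\<exists>q. set_pmf q \<subseteq> B \<and> (\<forall>a\<in>A. measure_pmf.expectation q (M a) < ?v))"
  proof
    assume "\<exists>q. set_pmf q \<subseteq> B \<and> (\<forall>a\<in>A. measure_pmf.expectation q (M a) < ?v)"
    then obtain q where q: "set_pmf q \<subseteq> B" "\<And>a. a \<in> A \<Longrightarrow> measure_pmf.expectation q (M a) < ?v"
      by blast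
    have "?v \<le> Max ((\<lambda>a. measure_pmf.expectation q (M a)) ` A)"
      using ne V_le[OF _ q(1)] A by (intro cSup_least) auto
    then show False
      using q(2) A by (auto simp: Max_ge_iff linorder_not_le[symmetric])
  qed
  then obtain p where p: "set_pmf p \<subseteq> A" "\<forall>b\<in>B. ?v \<le> measure_pmf.expectation p (\<lambda>a. M a b)"
    using matrix_game_alternative[OF A B(1), of ?v M] by blast
  have "\<not> (\<exists>p. set_pmf p \<subseteq> A \<and> (\<forall>b\<in>B. measure_pmf.expectation p (\<lambda>a. - M a b) < - ?v))"
  proof
    assume "\<exists>p. set_pmf p \<subseteq> A \<and> (\<forall>b\<in>B. measure_pmf.expectation p (\<lambda>a. - M a b) < - ?v)"
    then obtain p where p: "set_pmf p \<subseteq> A" "\<And>b. b \<in> B \<Longrightarrow> ?v < measure_pmf.expectation p (\<lambda>a. M a b)"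
      by auto
    have "Min ((\<lambda>b. measure_pmf.expectation p (\<lambda>a. M a b)) ` B) \<in> V"
      using p(1) B by (auto simp: V_def)
    then have "Min ((\<lambda>b. measure_pmf.expectation p (\<lambda>a. M a b)) ` B) \<le> ?v"
      using bdd by (rule cSup_upper)
    then show False
      using p(2) B by (auto simp: Min_le_iff linorder_not_le[symmetric])
  qed
  then obtain q where "set_pmf q \<subseteq> B" "\<forall>a\<in>A. - ?v \<le> measure_pmf.expectation q (\<lambda>b. - M a b)"
    using matrix_game_alternative[OF B A(1), of "- ?v" "\<lambda>b a. - M a b"] by blast
  with p show ?thesis
    by (auto simp: saddle_def)
qed

definition matrix_value :: "'a set \<Rightarrow> 'b set \<Rightarrow> ('a \<Rightarrow> 'b \<Rightarrow> real) \<Rightarrow> real" where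
  "matrix_value A B M = (SOME v. \<exists>p q. saddle A B M v p q)"

lemma saddle_matrix_value:
  assumes "finite A" "A \<noteq> {}" "finite B" "B \<noteq> {}"
  obtains p q where "saddle A B M (matrix_value A B M) p q"
  using someI_ex[OF minimax[OF assms, of M]] unfolding matrix_value_def by blast

lemma saddle_value_le:
  assumes "finite A" "finite B" "saddle A B M v p q" "saddle A B N u p' q'"
    and "\<And>a b. a \<in> A \<Longrightarrow> b \<in> B \<Longrightarrow> M a b \<le> N a b + e"
  shows "v \<le> u + e"
  using assms by (intro guarantee_le_guarantee[of A B p q' v M N]) (auto simp: saddle_def)

lemma saddle_unique:
  assumes "finite A" "finite B" "saddle A B M v p q"
  shows "matrix_value A B M = v"
proof -
  obtain p' q' where s: "saddle A B M (matrix_value A B M) p' q'"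
    using someI_ex[of "\<lambda>v. \<exists>p q. saddle A B M v p q"] assms(3) unfolding matrix_value_def by blast
  show ?thesis
    using saddle_value_le[OF assms(1,2) assms(3) s, of 0] saddle_value_le[OF assms(1,2) s assms(3), of 0]
    by simp
qed

section \<open>The Shapley operator\<close>

abbreviation local_game ::
  "('x, 'a, 'b) stoch_game \<Rightarrow> real \<Rightarrow> ('x \<Rightarrow> real) \<Rightarrow> 'x \<Rightarrow> 'a \<Rightarrow> 'b \<Rightarrow> real" where
  "local_game G s f x a b \<equiv> s * payoff G x a b + measure_pmf.expectation (trans_prob G x a b) f"

text \<open>
  The Shapley operator with a weight \<open>s\<close> on the current stage. The unnormalized operator is the one
  for \<open>s = 1\<close>. Keeping the weight as an argument treats all evaluations of the stage payoffs alike
  and makes the operator jointly positively homogeneous.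
\<close>

definition shapley :: "('x, 'a, 'b) stoch_game \<Rightarrow> real \<Rightarrow> ('x \<Rightarrow> real) \<Rightarrow> 'x \<Rightarrow> real" where
  "shapley G s f x = matrix_value (actions1 G x) (actions2 G x) (local_game G s f x)"

lemma stochastic_gameD:
  assumes "stochastic_game G"
  shows "finite (actions1 G x)" "actions1 G x \<noteq> {}" "finite (actions2 G x)" "actions2 G x \<noteq> {}"
    "\<bar>payoff G x a b\<bar> \<le> 1" "finite (set_pmf (trans_prob G x a b))"
  using assms by (auto simp: stochastic_game_def abs_le_iff minus_le_iff)

lemma shapley_saddle:
  assumes "stochastic_game G"
  obtains p q where "saddle (actions1 G x) (actions2 G x) (local_game G s f x) (shapley G s f x) p q"
proof -
  obtain p q where "saddle (actions1 G x) (actions2 G x) (local_game G s f x)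
      (matrix_value (actions1 G x) (actions2 G x) (local_game G s f x)) p q"
    by (rule saddle_matrix_value[OF stochastic_gameD(1-4)[OF assms]])
  then show thesis
    by (intro that) (simp add: shapley_def)
qed

lemma shapley_le:
  assumes G: "stochastic_game G" and fg: "\<And>x. f x \<le> g x + e"
  shows "shapley G s f x \<le> shapley G t g x + (\<bar>s - t\<bar> + e)"
proof -
  obtain p q where 1: "saddle (actions1 G x) (actions2 G x) (local_game G s f x) (shapley G s f x) p q"
    by (rule shapley_saddle[OF G])
  obtain p' q' where 2: "saddle (actions1 G x) (actions2 G x) (local_game G t g x) (shapley G t g x) p' q'"
    by (rule shapley_saddle[OF G])
  show ?thesis
  proof (rule saddle_value_le[OF _ _ 1 2])
    fix a b
    have "\<bar>(s - t) * payoff G x a b\<bar> \<le> \<bar>s - t\<bar> * 1"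
      unfolding abs_mult by (intro mult_left_mono stochastic_gameD[OF G]) simp
    then have "(s - t) * payoff G x a b \<le> \<bar>s - t\<bar> * 1"
      by (rule abs_le_D1)
    moreover have "measure_pmf.expectation (trans_prob G x a b) f \<le>
        measure_pmf.expectation (trans_prob G x a b) (\<lambda>y. g y + e)"
      by (intro expectation_mono stochastic_gameD[OF G] fg)
    ultimately show "local_game G s f x a b \<le> local_game G t g x a b + (\<bar>s - t\<bar> + e)"
      by (simp add: expectation_add stochastic_gameD[OF G] algebra_simps)
  qed (use stochastic_gameD[OF G] in auto)
qed

text \<open>
  Playing optimally in every local game, for the weights \<open>\<theta>\<close> and the continuation payoffs \<open>f\<close>, defines
  a pair of Markov strategies. The length of the history is the number of the stages played.
\<close>

lemma saddle_strategies:
  assumes G: "stochastic_game G"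
  shows "\<exists>\<sigma>\<in>strategies1 G. \<exists>\<tau>\<in>strategies2 G. \<forall>h x. saddle (actions1 G x) (actions2 G x)
      (local_game G (\<theta> (length h)) (f (Suc (length h))) x)
      (shapley G (\<theta> (length h)) (f (Suc (length h))) x) (\<sigma> h x) (\<tau> h x)"
proof -
  define P where "P h x pq \<longleftrightarrow> saddle (actions1 G x) (actions2 G x)
      (local_game G (\<theta> (length h)) (f (Suc (length h))) x)
      (shapley G (\<theta> (length h)) (f (Suc (length h))) x) (fst pq) (snd pq)"
    for h :: "('a \<times> 'b \<times> 'c) list" and x pq
  define S where "S h x = (SOME pq. P h x pq)" for h x
  have S: "P h x (S h x)" for h x
  proof -
    obtain p q where "P h x (p, q)"
      using shapley_saddle[OF G, of x "\<theta> (length h)" "f (Suc (length h))"] by (auto simp: P_def)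
    then show ?thesis
      unfolding S_def by (rule someI)
  qed
  show ?thesis
  proof (intro bexI allI)
    show "saddle (actions1 G x) (actions2 G x) (local_game G (\<theta> (length h)) (f (Suc (length h))) x)
      (shapley G (\<theta> (length h)) (f (Suc (length h))) x) (fst (S h x)) (snd (S h x))" for h x
      using S[of h x] by (simp add: P_def)
  qed (use S in \<open>auto simp: P_def saddle_def strategies1_def strategies2_def\<close>)
qed

text \<open>
  The bound \<open>c\<close> is there because \<open>SUP\<close> and \<open>INF\<close> on the reals are meaningful for bounded sets only.
\<close>

lemma game_value_eqI:
  fixes f :: "'s \<Rightarrow> 't \<Rightarrow> real"
  assumes s: "s \<in> S" "\<And>\<tau>. \<tau> \<in> T \<Longrightarrow> v \<le> f s \<tau>"
    and t: "t \<in> T" "\<And>\<sigma>. \<sigma> \<in> S \<Longrightarrow> f \<sigma> t \<le> v"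
    and c: "\<And>\<sigma> \<tau>. \<sigma> \<in> S \<Longrightarrow> \<tau> \<in> T \<Longrightarrow> \<bar>f \<sigma> \<tau>\<bar> \<le> c"
  shows "game_value S T f = v"
proof -
  have below: "bdd_below (f \<sigma> ` T)" if "\<sigma> \<in> S" for \<sigma>
    using c[OF that] by (intro bdd_belowI2[of _ "- c"]) (simp add: abs_le_iff minus_le_iff)
  have above: "bdd_above ((\<lambda>\<sigma>. f \<sigma> \<tau>) ` S)" if "\<tau> \<in> T" for \<tau>
    using c[OF _ that] by (intro bdd_aboveI2[of _ _ c]) (simp add: abs_le_iff)
  have inf_le: "(INF \<tau>\<in>T. f \<sigma> \<tau>) \<le> v" if "\<sigma> \<in> S" for \<sigma>
    using cINF_lower[OF below[OF that] t(1)] t(2)[OF that] by linarith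
  have le_sup: "v \<le> (SUP \<sigma>\<in>S. f \<sigma> \<tau>)" if "\<tau> \<in> T" for \<tau>
    using cSUP_upper[OF s(1) above[OF that]] s(2)[OF that] by linarith
  have 1: "(SUP \<sigma>\<in>S. INF \<tau>\<in>T. f \<sigma> \<tau>) = v"
  proof (rule antisym)
    show "(SUP \<sigma>\<in>S. INF \<tau>\<in>T. f \<sigma> \<tau>) \<le> v"
      using s(1) inf_le by (intro cSUP_least) auto
    have "v \<le> (INF \<tau>\<in>T. f s \<tau>)"
      using t(1) s(2) by (intro cINF_greatest) auto
    also have "\<dots> \<le> (SUP \<sigma>\<in>S. INF \<tau>\<in>T. f \<sigma> \<tau>)"
      using s(1) inf_le by (intro cSUP_upper bdd_aboveI2) auto
    finally show "v \<le> (SUP \<sigma>\<in>S. INF \<tau>\<in>T. f \<sigma> \<tau>)" .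
  qed
  have 2: "(INF \<tau>\<in>T. SUP \<sigma>\<in>S. f \<sigma> \<tau>) = v"
  proof (rule antisym)
    show "v \<le> (INF \<tau>\<in>T. SUP \<sigma>\<in>S. f \<sigma> \<tau>)"
      using t(1) le_sup by (intro cINF_greatest) auto
    have "(INF \<tau>\<in>T. SUP \<sigma>\<in>S. f \<sigma> \<tau>) \<le> (SUP \<sigma>\<in>S. f \<sigma> t)"
      using t(1) le_sup by (intro cINF_lower bdd_belowI2) auto
    also have "\<dots> \<le> v"
      using s(1) t(2) by (intro cSUP_least) auto
    finally show "(INF \<tau>\<in>T. SUP \<sigma>\<in>S. f \<sigma> \<tau>) \<le> v" .
  qed
  show ?thesis
    unfolding game_value_def has_value_def using 1 2 by auto
qed

section \<open>Expected payoffs under a pair of strategies\<close>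

locale strategy_profile =
  fixes G :: "('x, 'a, 'b) stoch_game" and x1 :: 'x
    and \<sigma> :: "('x, 'a, 'b) strategy1" and \<tau> :: "('x, 'a, 'b) strategy2"
  assumes G: "stochastic_game G" and \<sigma>: "\<sigma> \<in> strategies1 G" and \<tau>: "\<tau> \<in> strategies2 G"
begin

abbreviation hist :: "nat \<Rightarrow> ('x \<times> 'a \<times> 'b) list pmf" where
  "hist \<equiv> history_pmf G x1 \<sigma> \<tau>"

text \<open>
  Expectations under the law on plays are reduced to expectations over finite histories, where all
  laws have finite support.
\<close>

definition stage_mean :: "nat \<Rightarrow> real" where
  "stage_mean t = measure_pmf.expectation (hist (Suc t)) (\<lambda>h. case last h of (x, a, b) \<Rightarrow> payoff G x a b)"

definition continuation :: "nat \<Rightarrow> ('x \<Rightarrow> real) \<Rightarrow> real" where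
  "continuation n f =
     measure_pmf.expectation (hist n) (\<lambda>h. measure_pmf.expectation (next_state G x1 h) f)"

lemma finite_strategies: "finite (set_pmf (\<sigma> h x))" "finite (set_pmf (\<tau> h x))"
proof -
  have "set_pmf (\<sigma> h x) \<subseteq> actions1 G x" "set_pmf (\<tau> h x) \<subseteq> actions2 G x"
    using \<sigma> \<tau> by (auto simp: strategies1_def strategies2_def)
  then show "finite (set_pmf (\<sigma> h x))" "finite (set_pmf (\<tau> h x))"
    using stochastic_gameD(1,3)[OF G] by (auto intro: finite_subset)
qed

lemma finite_next_state: "finite (set_pmf (next_state G x1 h))"
  using stochastic_gameD(6)[OF G] by (auto simp: next_state_def split: prod.split)

lemma finite_next_history: "finite (set_pmf (next_history G x1 \<sigma> \<tau> h))"
  by (auto simp: next_history_def finite_next_state finite_strategies)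

lemma finite_hist: "finite (set_pmf (hist n))"
  by (induction n) (auto simp: finite_next_history)

lemma length_hist: "h \<in> set_pmf (hist n) \<Longrightarrow> length h = n"
  by (induction n arbitrary: h) (auto simp: next_history_def)

lemma expectation_next_history:
  "measure_pmf.expectation (next_history G x1 \<sigma> \<tau> h) F =
    measure_pmf.expectation (next_state G x1 h) (\<lambda>x.
      measure_pmf.expectation (\<sigma> h x) (\<lambda>a. measure_pmf.expectation (\<tau> h x) (\<lambda>b. F (h @ [(x, a, b)]))))"
  for F :: "('x \<times> 'a \<times> 'b) list \<Rightarrow> real"
proof -
  have "measure_pmf.expectation (map_pmf (\<lambda>(a, b). h @ [(x, a, b)]) (pair_pmf (\<sigma> h x) (\<tau> h x))) F =
      measure_pmf.expectation (\<sigma> h x) (\<lambda>a. measure_pmf.expectation (\<tau> h x) (\<lambda>b. F (h @ [(x, a, b)])))" for x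
    using expectation_pair[OF finite_strategies, where M = "\<lambda>a b. F (h @ [(x, a, b)])"]
    by (simp add: case_prod_unfold)
  then show ?thesis
    unfolding next_history_def
    by (subst expectation_bind) (auto simp: finite_next_state finite_strategies)
qed

text \<open>
  One step of dynamic programming: given the history before stage \<open>n\<close> and its state, the payoff of
  that stage and the continuation after it add up to the payoff of a local game.
\<close>

lemma stage_plus_continuation:
  "s * stage_mean n + continuation (Suc n) f =
    measure_pmf.expectation (hist n) (\<lambda>h. measure_pmf.expectation (next_state G x1 h) (\<lambda>x.
      measure_pmf.expectation (\<sigma> h x) (\<lambda>a. measure_pmf.expectation (\<tau> h x) (local_game G s f x a))))"
proof -
  let ?F = "\<lambda>h. s * (case last h of (x, a, b) \<Rightarrow> payoff G x a b) +
    measure_pmf.expectation (next_state G x1 h) f"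
  have "s * stage_mean n + continuation (Suc n) f = measure_pmf.expectation (hist (Suc n)) ?F"
    by (simp only: stage_mean_def continuation_def expectation_add[OF finite_hist] integral_mult_right_zero)
  also have "\<dots> = measure_pmf.expectation (hist n)
      (\<lambda>h. measure_pmf.expectation (next_history G x1 \<sigma> \<tau> h) ?F)"
    unfolding history_pmf.simps by (rule expectation_bind[OF finite_hist finite_next_history])
  finally show ?thesis
    by (simp add: expectation_next_history next_state_def)
qed

lemma continuation_0: "continuation 0 f = f x1"
  by (simp add: continuation_def next_state_def)

lemma continuation_abs_le: "(\<And>x. \<bar>f x\<bar> \<le> c) \<Longrightarrow> \<bar>continuation n f\<bar> \<le> c"
  unfolding continuation_def by (intro expectation_abs_le finite_hist finite_next_state)

lemma stage_mean_abs_le: "\<bar>stage_mean t\<bar> \<le> 1"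
  unfolding stage_mean_def
  by (intro expectation_abs_le finite_hist) (auto split: prod.split intro: stochastic_gameD[OF G])

text \<open>
  The weighted payoff of the first \<open>n\<close> stages plus the continuation payoff is nondecreasing in \<open>n\<close>
  in expectation, because each step guarantees the value of the local game. At \<open>n = 0\<close> it is
  \<open>f 0 x1\<close>. The same argument with the inequalities reversed serves player 2.
\<close>

lemma optimal1_payoff_ge:
  assumes f: "\<And>t. t < n \<Longrightarrow> f t = shapley G (\<theta> t) (f (Suc t))"
    and sad: "\<And>h x. \<exists>q. saddle (actions1 G x) (actions2 G x)
      (local_game G (\<theta> (length h)) (f (Suc (length h))) x)
      (shapley G (\<theta> (length h)) (f (Suc (length h))) x) (\<sigma> h x) q"
  shows "f 0 x1 \<le> (\<Sum>t<n. \<theta> t * stage_mean t) + continuation n (f n)"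
  using f
proof (induction n)
  case (Suc n)
  have "continuation n (f n) \<le> \<theta> n * stage_mean n + continuation (Suc n) (f (Suc n))"
    unfolding stage_plus_continuation unfolding continuation_def
  proof (intro expectation_mono finite_hist finite_next_state)
    fix h x
    assume "h \<in> set_pmf (hist n)"
    then have n: "length h = n"
      by (rule length_hist)
    have ge: "f n x \<le> measure_pmf.expectation (\<sigma> h x) (\<lambda>a. local_game G (\<theta> n) (f (Suc n)) x a b)"
      if "b \<in> set_pmf (\<tau> h x)" for b
    proof -
      have "b \<in> actions2 G x"
        using that \<tau> by (auto simp: strategies2_def)
      then show ?thesis
        using sad[of x h] Suc.prems[of n] by (auto simp: saddle_def n)
    qed
    have "f n x = measure_pmf.expectation (\<tau> h x) (\<lambda>b. f n x)"
      by simp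
    also have "\<dots> \<le> measure_pmf.expectation (\<tau> h x) (\<lambda>b. measure_pmf.expectation (\<sigma> h x)
        (\<lambda>a. local_game G (\<theta> n) (f (Suc n)) x a b))"
      by (intro expectation_mono finite_strategies ge)
    also have "\<dots> = measure_pmf.expectation (\<sigma> h x) (\<lambda>a. measure_pmf.expectation (\<tau> h x)
        (local_game G (\<theta> n) (f (Suc n)) x a))"
      by (rule expectation_swap[OF finite_strategies(2,1)])
    finally show "f n x \<le> measure_pmf.expectation (\<sigma> h x) (\<lambda>a. measure_pmf.expectation (\<tau> h x)
        (local_game G (\<theta> n) (f (Suc n)) x a))" .
  qed
  with Suc.IH[OF Suc.prems] show ?case
    by simp
qed (simp add: continuation_0)

lemma optimal2_payoff_le:
  assumes f: "\<And>t. t < n \<Longrightarrow> f t = shapley G (\<theta> t) (f (Suc t))"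
    and sad: "\<And>h x. \<exists>p. saddle (actions1 G x) (actions2 G x)
      (local_game G (\<theta> (length h)) (f (Suc (length h))) x)
      (shapley G (\<theta> (length h)) (f (Suc (length h))) x) p (\<tau> h x)"
  shows "(\<Sum>t<n. \<theta> t * stage_mean t) + continuation n (f n) \<le> f 0 x1"
  using f
proof (induction n)
  case (Suc n)
  have "\<theta> n * stage_mean n + continuation (Suc n) (f (Suc n)) \<le> continuation n (f n)"
    unfolding stage_plus_continuation unfolding continuation_def
  proof (intro expectation_mono finite_hist finite_next_state)
    fix h x
    assume "h \<in> set_pmf (hist n)"
    then have n: "length h = n"
      by (rule length_hist)
    have le: "measure_pmf.expectation (\<tau> h x) (local_game G (\<theta> n) (f (Suc n)) x a) \<le> f n x"
      if "a \<in> set_pmf (\<sigma> h x)" for a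
    proof -
      have "a \<in> actions1 G x"
        using that \<sigma> by (auto simp: strategies1_def)
      then show ?thesis
        using sad[of x h] Suc.prems[of n] by (auto simp: saddle_def n)
    qed
    have "measure_pmf.expectation (\<sigma> h x) (\<lambda>a. measure_pmf.expectation (\<tau> h x)
        (local_game G (\<theta> n) (f (Suc n)) x a)) \<le> measure_pmf.expectation (\<sigma> h x) (\<lambda>a. f n x)"
      by (intro expectation_mono finite_strategies le)
    then show "measure_pmf.expectation (\<sigma> h x) (\<lambda>a. measure_pmf.expectation (\<tau> h x)
        (local_game G (\<theta> n) (f (Suc n)) x a)) \<le> f n x"
      by simp
  qed
  with Suc.IH[OF Suc.prems] show ?case
    by simp
qed (simp add: continuation_0)

abbreviation play :: "(nat \<Rightarrow> 'x \<times> 'a \<times> 'b) measure" where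
  "play \<equiv> play_law G x1 \<sigma> \<tau>"

lemma sets_play: "sets play = sets (PiM UNIV (\<lambda>_. count_space UNIV))"
  by (simp add: play_law_def)

lemma space_play: "space play = UNIV"
  using sets_eq_imp_space_eq[OF sets_play] by (simp add: space_PiM)

lemma stage_payoff_measurable: "(\<lambda>\<omega>. stage_payoff G \<omega> t) \<in> borel_measurable play"
proof -
  have "(\<lambda>\<omega>. \<omega> t) \<in> measurable play (count_space UNIV)"
    unfolding measurable_cong_sets[OF sets_play refl] by (rule measurable_component_singleton) simp
  then show ?thesis
    unfolding stage_payoff_def by (rule measurable_compose) simp
qed

lemma stage_payoff_abs_le: "\<bar>stage_payoff G \<omega> t\<bar> \<le> 1"
  by (auto simp: stage_payoff_def stochastic_gameD[OF G] split: prod.split)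

lemma stage_payoff_integrable: "integrable play (\<lambda>\<omega>. stage_payoff G \<omega> t)"
proof -
  interpret prob_space play
    by (rule prob_space_play_law)
  show ?thesis
    by (rule integrable_const_bound[of _ 1]) (simp_all add: stage_payoff_abs_le stage_payoff_measurable)
qed

text \<open>
  The law on plays is only known on cylinders. The history up to stage \<open>t\<close> takes finitely many values
  almost surely, so up to a null set the stage payoff is a finite sum of indicators of cylinders.
\<close>

lemma integral_stage_payoff: "(\<integral>\<omega>. stage_payoff G \<omega> t \<partial>play) = stage_mean t"
proof -
  interpret prob_space play
    by (rule prob_space_play_law)
  let ?S = "set_pmf (hist (Suc t))"
  define cyl where "cyl w = {\<omega>. map \<omega> [0..<Suc t] = w}" for w :: "('x \<times> 'a \<times> 'b) list"
  define r where "r w = (case last w of (x, a, b) \<Rightarrow> payoff G x a b)" for w :: "('x \<times> 'a \<times> 'b) list"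
  have cyl: "cyl w \<in> sets play" for w
  proof -
    have "cyl w = (if length w = Suc t then
        prod_emb UNIV (\<lambda>_. count_space UNIV) {0..<Suc t} (\<Pi>\<^sub>E i\<in>{0..<Suc t}. {w ! i}) else {})"
      unfolding cyl_def list_eq_iff_nth_eq[of "map _ _"]
      by (auto simp: prod_emb_def space_PiM PiE_def Pi_def simp del: upt_Suc)
    moreover have "prod_emb UNIV (\<lambda>_. count_space UNIV) {0..<Suc t} (\<Pi>\<^sub>E i\<in>{0..<Suc t}. {w ! i}) \<in> sets play"
      unfolding sets_play by (intro sets_PiM_I) auto
    ultimately show ?thesis
      by simp
  qed
  have prob: "prob (cyl w) = pmf (hist (Suc t)) w" if "w \<in> ?S" for w
    using emeasure_play_law_cylinder[of G x1 \<sigma> \<tau> w] length_hist[OF that]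
    by (simp add: cyl_def emeasure_eq_measure del: upt_Suc history_pmf.simps)
  have "prob (\<Union>w\<in>?S. cyl w) = (\<Sum>w\<in>?S. prob (cyl w))"
    using cyl finite_hist by (intro finite_measure_finite_Union) (auto simp: disjoint_family_on_def cyl_def simp del: upt_Suc history_pmf.simps)
  also have "\<dots> = 1"
    using finite_hist by (simp add: prob sum_pmf_eq_1 del: history_pmf.simps)
  finally have "AE \<omega> in play. \<omega> \<in> (\<Union>w\<in>?S. cyl w)"
    by (rule AE_prob_1)
  then have AE: "AE \<omega> in play. stage_payoff G \<omega> t = (\<Sum>w\<in>?S. r w * indicator (cyl w) \<omega>)"
  proof (rule AE_mp, intro AE_I2 impI)
    fix \<omega> assume "\<omega> \<in> (\<Union>w\<in>?S. cyl w)"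
    then have "map \<omega> [0..<Suc t] \<in> ?S"
      by (auto simp: cyl_def simp del: upt_Suc history_pmf.simps)
    moreover have "(\<Sum>w\<in>?S. r w * indicator (cyl w) \<omega>) =
        (\<Sum>w\<in>?S. if w = map \<omega> [0..<Suc t] then r w else 0)"
      by (intro sum.cong) (auto simp: cyl_def indicator_def simp del: upt_Suc)
    ultimately show "stage_payoff G \<omega> t = (\<Sum>w\<in>?S. r w * indicator (cyl w) \<omega>)"
      using finite_hist[of "Suc t"] by (simp add: sum.delta r_def stage_payoff_def del: history_pmf.simps)
  qed
  have "(\<integral>\<omega>. stage_payoff G \<omega> t \<partial>play) = (\<integral>\<omega>. (\<Sum>w\<in>?S. r w * indicator (cyl w) \<omega>) \<partial>play)"
    using AE cyl by (intro integral_cong_AE stage_payoff_measurable) auto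
  also have "\<dots> = (\<Sum>w\<in>?S. r w * prob (cyl w))"
    using cyl by (subst Bochner_Integration.integral_sum) (auto simp: emeasure_eq_measure space_play)
  also have "\<dots> = stage_mean t"
    unfolding stage_mean_def expectation_eq_sum[OF finite_hist order_refl]
    by (intro sum.cong) (auto simp: prob r_def mult.commute simp del: history_pmf.simps)
  finally show ?thesis .
qed

lemma payoff_n_eq: "payoff_n G n x1 \<sigma> \<tau> = (\<Sum>t<n. 1 / n * stage_mean t)"
  by (simp add: payoff_n_def integral_stage_payoff stage_payoff_integrable sum_divide_distrib)

lemma payoff_disc_sums:
  assumes l: "0 < l" "l \<le> 1"
  shows "(\<lambda>t. l * (1 - l) ^ t * stage_mean t) sums payoff_disc G l x1 \<sigma> \<tau>"
proof -
  have le: "\<bar>(1 - l) ^ t * stage_payoff G \<omega> t\<bar> \<le> (1 - l) ^ t" for t \<omega>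
    using l stage_payoff_abs_le[of \<omega> t] by (simp add: abs_mult mult_left_le)
  have geo: "summable (\<lambda>t. (1 - l) ^ t)"
    using l by (intro summable_geometric) simp
  interpret prob_space play
    by (rule prob_space_play_law)
  have int: "integrable play (\<lambda>\<omega>. (1 - l) ^ t * stage_payoff G \<omega> t)" for t
    by (intro integrable_mult_right stage_payoff_integrable)
  have "(\<lambda>t. \<integral>\<omega>. (1 - l) ^ t * stage_payoff G \<omega> t \<partial>play) sums
      (\<integral>\<omega>. (\<Sum>t. (1 - l) ^ t * stage_payoff G \<omega> t) \<partial>play)"
  proof (rule sums_integral[OF int])
    show "AE \<omega> in play. summable (\<lambda>t. norm ((1 - l) ^ t * stage_payoff G \<omega> t))"
      using le by (intro AE_I2 summable_comparison_test'[OF geo]) auto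
    have "(\<integral>\<omega>. norm ((1 - l) ^ t * stage_payoff G \<omega> t) \<partial>play) \<le> (1 - l) ^ t" for t
      using le int by (intro integral_le_const integrable_norm AE_I2) simp_all
    then show "summable (\<lambda>t. \<integral>\<omega>. norm ((1 - l) ^ t * stage_payoff G \<omega> t) \<partial>play)"
      by (intro summable_comparison_test'[OF geo]) simp
  qed
  from sums_mult[OF this, of l] show ?thesis
    by (simp add: payoff_disc_def integral_stage_payoff mult.assoc)
qed

end

section \<open>Iterates and fixed points of homogeneous nonexpansive operators\<close>

text \<open>
  These are the two properties of the Shapley operator that enter the comparison of the two families.
  Nonexpansiveness in the stage weight reflects that payoffs are bounded by \<open>1\<close>. Functions are
  compared pointwise, with one bound for all states, which expresses the supremum norm without a type of bounded
  functions.
\<close>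

locale homogeneous_nonexpansive =
  fixes T :: "real \<Rightarrow> ('x \<Rightarrow> real) \<Rightarrow> 'x \<Rightarrow> real"
  assumes nonexpansive: "(\<And>x. \<bar>f x - g x\<bar> \<le> e) \<Longrightarrow> \<bar>T s f x - T t g x\<bar> \<le> \<bar>s - t\<bar> + e"
    and homogeneous: "0 \<le> c \<Longrightarrow> T (c * s) (\<lambda>x. c * f x) = (\<lambda>x. c * T s f x)"
begin

abbreviation discounted_step :: "real \<Rightarrow> ('x \<Rightarrow> real) \<Rightarrow> 'x \<Rightarrow> real" where
  "discounted_step l f \<equiv> T l (\<lambda>x. (1 - l) * f x)"

text \<open>
  The value of the \<open>n\<close>-stage game whose payoff is the sum of the stage payoffs.
\<close>

abbreviation total_value :: "nat \<Rightarrow> 'x \<Rightarrow> real" where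
  "total_value n \<equiv> (T 1 ^^ n) (\<lambda>_. 0)"

lemma T_zero: "T 0 (\<lambda>_. 0) = (\<lambda>_. 0)"
  using homogeneous[of 0 0 "\<lambda>_. 0"] by simp

lemma T_bound:
  assumes "\<And>x. \<bar>f x\<bar> \<le> c"
  shows "\<bar>T s f x\<bar> \<le> \<bar>s\<bar> + c"
  using nonexpansive[of f "\<lambda>_. 0" c s x 0] assms by (simp add: T_zero)

lemma funpow_nonexpansive:
  assumes "\<And>x. \<bar>f x - g x\<bar> \<le> e"
  shows "\<bar>(T s ^^ p) f x - (T t ^^ p) g x\<bar> \<le> p * \<bar>s - t\<bar> + e"
proof (induction p arbitrary: x)
  case (Suc p)
  show ?case
    using nonexpansive[of "(T s ^^ p) f" "(T t ^^ p) g" _ s x t, OF Suc.IH] by (simp add: algebra_simps)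
qed (use assms in simp)

lemma funpow_homogeneous:
  assumes "0 \<le> c"
  shows "(T (c * s) ^^ p) (\<lambda>x. c * f x) = (\<lambda>x. c * (T s ^^ p) f x)"
  by (induction p) (simp_all add: homogeneous[OF assms])

lemma total_bound: "\<bar>total_value n x\<bar> \<le> n"
proof (induction n arbitrary: x)
  case (Suc n)
  then show ?case
    using T_bound[of "total_value n" n 1 x] by simp
qed simp

lemma discounted_contraction:
  assumes "l \<le> 1" "\<And>x. \<bar>f x - g x\<bar> \<le> e"
  shows "\<bar>discounted_step l f x - discounted_step l g x\<bar> \<le> (1 - l) * e"
proof -
  have "\<bar>(1 - l) * f x - (1 - l) * g x\<bar> \<le> (1 - l) * e" for x
    using assms by (simp add: abs_mult mult_left_mono flip: right_diff_distrib)
  then show ?thesis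
    using nonexpansive[of "\<lambda>x. (1 - l) * f x" "\<lambda>x. (1 - l) * g x" "(1 - l) * e" l x l] by simp
qed

lemma funpow_discounted_contraction:
  assumes "l \<le> 1" "\<And>x. \<bar>f x - g x\<bar> \<le> e"
  shows "\<bar>(discounted_step l ^^ p) f x - (discounted_step l ^^ p) g x\<bar> \<le> (1 - l) ^ p * e"
proof (induction p arbitrary: x)
  case (Suc p)
  show ?case
    using discounted_contraction[of l "(discounted_step l ^^ p) f" "(discounted_step l ^^ p) g" _ x, OF assms(1) Suc.IH] by (simp add: mult.assoc)
qed (use assms in simp)

text \<open>
  Banach's fixed point theorem for the contraction with factor \<open>1 - l\<close>: the iterates at \<open>0\<close> form a
  Cauchy sequence at every state, with a rate that is the same for all states.
\<close>

lemma discounted_fixpoint_exists: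
  assumes l: "0 < l" "l \<le> 1"
  shows "\<exists>u. discounted_step l u = u \<and> (\<forall>x. \<bar>u x\<bar> \<le> 1)"
proof -
  define w where "w k = (discounted_step l ^^ k) (\<lambda>_. 0)" for k
  have w_Suc: "w (Suc k) = discounted_step l (w k)" for k
    by (simp add: w_def)
  have w_le: "\<bar>w k x\<bar> \<le> 1" for k x
  proof (induction k arbitrary: x)
    case (Suc k)
    have "\<bar>(1 - l) * w k y\<bar> \<le> 1 - l" for y
      using l Suc by (simp add: abs_mult mult_left_le)
    from T_bound[of "\<lambda>x. (1 - l) * w k x" "1 - l" l x, OF this] show ?case
      using l by (simp add: w_Suc)
  qed (simp add: w_def)
  have dist: "\<bar>w (k + m) x - w k x\<bar> \<le> (1 - l) ^ k" for k m x
    using funpow_discounted_contraction[OF l(2), of "w m" "\<lambda>_. 0" 1 k x] w_le[of m]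
    by (simp add: w_def funpow_add)
  have pow: "(\<lambda>k. (1 - l) ^ k) \<longlonglongrightarrow> 0"
    using l by (intro LIMSEQ_power_zero) simp
  have Cauchy: "Cauchy (\<lambda>k. w k x)" for x
  proof (rule metric_CauchyI)
    fix e :: real assume "0 < e"
    then obtain K where K: "\<And>k. k \<ge> K \<Longrightarrow> (1 - l) ^ k < e / 2"
      using order_tendstoD(2)[OF pow, of "e / 2"] by (auto simp: eventually_sequentially)
    have "dist (w m x) (w n x) < e" if "m \<ge> K" "n \<ge> K" for m n
      using dist[of K "m - K" x] dist[of K "n - K" x] K[of K] that by (simp add: dist_real_def)
    then show "\<exists>M. \<forall>m\<ge>M. \<forall>n\<ge>M. dist (w m x) (w n x) < e"
      by blast
  qed
  define u where "u x = lim (\<lambda>k. w k x)" for x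
  have u: "(\<lambda>k. w k x) \<longlonglongrightarrow> u x" for x
    unfolding u_def using Cauchy_convergent[OF Cauchy] by (simp add: convergent_LIMSEQ_iff)
  have near: "\<bar>w k x - u x\<bar> \<le> (1 - l) ^ k" for k x
  proof (rule LIMSEQ_le_const2)
    show "(\<lambda>m. \<bar>w k x - w (m + k) x\<bar>) \<longlonglongrightarrow> \<bar>w k x - u x\<bar>"
      by (intro tendsto_intros LIMSEQ_ignore_initial_segment u)
    show "\<exists>N. \<forall>m\<ge>N. \<bar>w k x - w (m + k) x\<bar> \<le> (1 - l) ^ k"
      using dist[of k _ x] by (auto simp: abs_minus_commute add.commute)
  qed
  have "(\<lambda>k. w (Suc k) x) \<longlonglongrightarrow> discounted_step l u x" for x
  proof (rule LIMSEQ_I)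
    fix e :: real assume "0 < e"
    then obtain K where K: "\<And>k. k \<ge> K \<Longrightarrow> (1 - l) ^ k < e"
      using order_tendstoD(2)[OF pow, of e] by (auto simp: eventually_sequentially)
    have "norm (w (Suc k) x - discounted_step l u x) < e" if "k \<ge> K" for k
    proof -
      have "\<bar>w (Suc k) x - discounted_step l u x\<bar> \<le> (1 - l) * (1 - l) ^ k"
        unfolding w_Suc by (rule discounted_contraction[OF l(2) near])
      also have "\<dots> \<le> (1 - l) ^ k"
        using l by (simp add: mult_left_le_one_le)
      finally show ?thesis
        using K[OF that] by simp
    qed
    then show "\<exists>no. \<forall>n\<ge>no. norm (w (Suc n) x - discounted_step l u x) < e"
      by blast
  qed
  then have "discounted_step l u x = u x" for x
    using LIMSEQ_unique LIMSEQ_Suc[OF u] by blast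
  moreover have "\<bar>u x\<bar> \<le> 1" for x
    using tendsto_rabs[OF u[of x]] w_le by (intro LIMSEQ_le_const2) auto
  ultimately show ?thesis
    by blast
qed

text \<open>
  The key comparison. Along a block of \<open>p\<close> stages the discounted weights \<open>l * (1 - l) ^ k\<close> differ from
  the constant weight \<open>l\<close> by at most \<open>p * l\<^sup>2\<close> each, and the weight \<open>(1 - l) ^ p\<close> of the future differs
  from \<open>1 - p * l\<close> by at most \<open>(p * l)\<^sup>2\<close>. So on a block that carries the total weight \<open>p * l = d\<close> the two
  evaluations differ only by an amount of order \<open>d\<^sup>2\<close>, although their payoffs have order \<open>d\<close>. In the
  induction, both sources of error contribute \<open>p * l\<^sup>2\<close> to the step from \<open>p\<close> to \<open>p + 1\<close>.
\<close>

lemma discounted_block: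
  assumes l: "0 \<le> l" and p: "p * l \<le> 1" and f: "\<And>x. \<bar>f x\<bar> \<le> 1"
  shows "\<bar>(discounted_step l ^^ p) f x - (T l ^^ p) (\<lambda>x. (1 - p * l) * f x) x\<bar> \<le> (p * l)\<^sup>2"
  using p
proof (induction p arbitrary: x)
  case (Suc p)
  have "0 \<le> p * l"
    using l by simp
  then have pl: "p * l \<le> 1" "l \<le> 1"
    using Suc.prems l unfolding of_nat_Suc ring_distribs by linarith+
  let ?S = "\<lambda>p. (T l ^^ p) (\<lambda>x. (1 - p * l) * f x)"
  have "\<bar>(1 - l) * (discounted_step l ^^ p) f y - (T l ^^ p) (\<lambda>x. (1 - Suc p * l) * f x) y\<bar> \<le> (Suc p * l)\<^sup>2" for y
  proof -
    have "\<bar>(1 - l) * (discounted_step l ^^ p) f y - (1 - l) * ?S p y\<bar> \<le> (1 - l) * (p * l)\<^sup>2"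
      using pl Suc.IH[OF pl(1), of y] by (simp add: abs_mult mult_left_mono flip: right_diff_distrib)
    also have "\<dots> \<le> (p * l)\<^sup>2"
      using l pl by (simp add: mult_left_le_one_le)
    finally have 1: "\<bar>(1 - l) * (discounted_step l ^^ p) f y - (1 - l) * ?S p y\<bar> \<le> (p * l)\<^sup>2" .
    have "\<bar>(1 - l) * ((1 - p * l) * f z) - (1 - Suc p * l) * f z\<bar> \<le> p * l\<^sup>2" for z
    proof -
      have "(1 - l) * ((1 - p * l) * f z) - (1 - Suc p * l) * f z = p * l\<^sup>2 * f z"
        by (simp add: algebra_simps power2_eq_square)
      then show ?thesis
        using f[of z] by (simp add: abs_mult mult_left_le)
    qed
    from funpow_nonexpansive[of "\<lambda>z. (1 - l) * ((1 - real p * l) * f z)" "\<lambda>z. (1 - real (Suc p) * l) * f z" _ p "(1 - l) * l" y l, OF this]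
    have bound: "\<bar>(T ((1 - l) * l) ^^ p) (\<lambda>z. (1 - l) * ((1 - p * l) * f z)) y - (T l ^^ p) (\<lambda>z. (1 - Suc p * l) * f z) y\<bar>
        \<le> p * \<bar>(1 - l) * l - l\<bar> + p * l\<^sup>2" .
    have 2: "\<bar>(1 - l) * ?S p y - (T l ^^ p) (\<lambda>x. (1 - Suc p * l) * f x) y\<bar> \<le> 2 * p * l\<^sup>2"
    proof -
      have hom: "(T ((1 - l) * l) ^^ p) (\<lambda>z. (1 - l) * ((1 - p * l) * f z)) = (\<lambda>z. (1 - l) * ?S p z)"
        using pl by (intro funpow_homogeneous) simp
      have err: "p * \<bar>(1 - l) * l - l\<bar> + p * l\<^sup>2 = 2 * p * l\<^sup>2"
        by (simp add: algebra_simps power2_eq_square)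
      show ?thesis
        using bound unfolding hom err .
    qed
    have "(p * l)\<^sup>2 + 2 * p * l\<^sup>2 \<le> (Suc p * l)\<^sup>2"
      by (simp add: algebra_simps power2_eq_square)
    with 1 2 show ?thesis by linarith
  qed
  from nonexpansive[of "\<lambda>y. (1 - l) * (discounted_step l ^^ p) f y" "(T l ^^ p) (\<lambda>x. (1 - real (Suc p) * l) * f x)" _ l x l, OF this] show ?case
    by simp
qed simp

text \<open>
  The first \<open>p\<close> of \<open>n\<close> stages, in payoff units of size \<open>c\<close>.
\<close>

lemma total_block:
  assumes "0 \<le> c" "p \<le> n"
  shows "c * total_value n x = (T c ^^ p) (\<lambda>x. c * total_value (n - p) x) x"
proof -
  have "total_value n = (T 1 ^^ p) (total_value (n - p))"
    using assms(2) by (metis comp_apply funpow_add le_add_diff_inverse)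
  then show ?thesis
    using funpow_homogeneous[OF assms(1), of p 1 "total_value (n - p)"] by simp
qed

text \<open>
  Cut the \<open>n\<close>-stage game into blocks, each of which covers about a fraction \<open>d\<close> of the remaining
  stages. On the first block, the \<open>n\<close>-stage game resembles the game with discount factor \<open>1 / n\<close>,
  whose value is within \<open>d\<^sup>2\<close> of \<open>v\<close> if \<open>n\<close> is large. Hence the error in the total payoff grows by
  \<open>O(d\<^sup>2 * n)\<close>, that is by \<open>O(d)\<close> per stage of the block. Summing over the blocks leaves an error of
  \<open>O(d)\<close> in the mean payoff.
\<close>

theorem mean_values_converge:
  assumes fixpoint: "\<And>l. 0 < l \<Longrightarrow> l \<le> 1 \<Longrightarrow> discounted_step l (u l) = u l"
    and u_le: "\<And>l x. 0 < l \<Longrightarrow> l \<le> 1 \<Longrightarrow> \<bar>u l x\<bar> \<le> 1"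
    and lim: "uniform_limit UNIV u v (at_right 0)"
  shows "uniform_limit UNIV (\<lambda>n x. total_value n x / n) v sequentially"
proof -
  have v_le: "\<bar>v x\<bar> \<le> 1" for x
  proof (rule tendsto_upperbound)
    show "((\<lambda>l. \<bar>u l x\<bar>) \<longlongrightarrow> \<bar>v x\<bar>) (at_right 0)"
      using tendsto_uniform_limitI[OF lim] by (intro tendsto_rabs) simp
    show "\<forall>\<^sub>F l in at_right 0. \<bar>u l x\<bar> \<le> 1"
      unfolding eventually_at_right_field using u_le by (intro exI[of _ 1]) auto
  qed simp
  have rate: "\<exists>N::nat. \<forall>n x. \<bar>total_value n x - n * v x\<bar> \<le> real N + 6 * d * n" if d: "0 < d" "d < 1" for d
  proof -
    have "\<forall>\<^sub>F l in at_right 0. \<forall>x\<in>UNIV. dist (u l x) (v x) < d\<^sup>2"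
      using lim d unfolding uniform_limit_iff by simp
    then obtain r where r: "0 < r" "\<And>l x. 0 < l \<Longrightarrow> l < r \<Longrightarrow> \<bar>u l x - v x\<bar> < d\<^sup>2"
      by (auto simp: eventually_at_right_field dist_real_def)
    obtain N :: nat where "max (1 / r) (2 / d) < N"
      using reals_Archimedean2 by blast
    then have N: "1 / r < N" "2 / d < N"
      by auto
    have "\<forall>x. \<bar>total_value n x - n * v x\<bar> \<le> 2 * N + 6 * d * n" for n
    proof (induction n rule: less_induct)
      case (less n)
      show ?case
      proof (cases "n < N")
        case True
        have "\<bar>total_value n x - n * v x\<bar> \<le> n + n * 1" for x
        proof -
          have "\<bar>n * v x\<bar> \<le> real n * 1"
            unfolding abs_mult using v_le[of x] by (intro mult_mono) auto
          then show ?thesis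
            using total_bound[of n x] by linarith
        qed
        also have "n + n * 1 \<le> 2 * N + 6 * d * n"
          using True d by (simp add: add_increasing2)
        finally show ?thesis by simp
      next
        case False
        then have n: "1 / r < n" "2 / d < n"
          using N by linarith+
        have n0: "0 < n"
          using n d r by (cases n) auto
        (* Since d * n > 2, rounding keeps p between d * n / 2 and d * n. *)
        define p where "p = nat \<lfloor>d * n\<rfloor>"
        have dn: "2 < d * n"
          using n(2) d by (simp add: field_simps)
        have p: "p \<le> d * n" "d * n \<le> 2 * p"
          using dn by (simp_all add: p_def) linarith
        have pn: "p \<le> n" "0 < p"
        proof -
          have "real p \<le> n"
            using p(1) d by (smt (verit) mult_left_le_one_le of_nat_0_le_iff)
          then show "p \<le> n" by simp
          show "0 < p" using p(2) dn by (cases p) auto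
        qed
        define l where "l = 1 / real n"
        have l: "0 < l" "l \<le> 1" "l < r" "n * l = 1"
          using n0 n r by (auto simp: l_def field_simps)
        have near: "\<bar>u l x - v x\<bar> \<le> d\<^sup>2" for x
          using r(2)[OF l(1,3)] by (simp add: less_imp_le)
        have pl: "p * l \<le> d"
          using p(1) n0 by (simp add: l_def field_simps)
        have "\<bar>total_value n x - n * v x\<bar> \<le> 2 * N + 6 * d * n" for x
        proof -
          have "(discounted_step l ^^ p) (u l) = u l"
            by (induction p) (simp_all add: fixpoint l)
          then have "\<bar>u l x - (T l ^^ p) (\<lambda>x. (1 - p * l) * u l x) x\<bar> \<le> (p * l)\<^sup>2"
            using discounted_block[of l p "u l" x] l pl d u_le[OF l(1,2)] by simp
          also have "\<dots> \<le> d\<^sup>2"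
            using pl l by (intro power_mono) auto
          finally have 1: "\<bar>u l x - (T l ^^ p) (\<lambda>x. (1 - p * l) * u l x) x\<bar> \<le> d\<^sup>2" .
          have 2: "\<bar>(T l ^^ p) (\<lambda>x. (1 - p * l) * u l x) x - l * total_value n x\<bar>
              \<le> d\<^sup>2 + l * (2 * N + 6 * d * (n - p))"
          proof -
            have "\<bar>(1 - p * l) * u l y - l * total_value (n - p) y\<bar> \<le> d\<^sup>2 + l * (2 * N + 6 * d * (n - p))" for y
            proof -
              have eq: "1 - p * l = l * real (n - p)"
                using l pn by (simp add: of_nat_diff algebra_simps)
              have "\<bar>(1 - p * l) * (u l y - v y)\<bar> \<le> 1 * d\<^sup>2"
                unfolding abs_mult using near l pl d by (intro mult_mono) auto
              moreover have "\<bar>l * (real (n - p) * v y - total_value (n - p) y)\<bar> \<le> l * (2 * N + 6 * d * (n - p))"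
                unfolding abs_mult using less.IH[of "n - p"] pn l
                by (intro mult_mono) (auto simp: abs_minus_commute)
              moreover have "(1 - p * l) * u l y - l * total_value (n - p) y =
                  (1 - p * l) * (u l y - v y) + l * (real (n - p) * v y - total_value (n - p) y)"
                unfolding eq by (simp add: algebra_simps)
              ultimately show ?thesis
                by linarith
            qed
            from funpow_nonexpansive[of "\<lambda>y. (1 - real p * l) * u l y" "\<lambda>y. l * total_value (n - p) y" _ p l x l, OF this] show ?thesis
              using total_block[of l p n x] l pn by simp
          qed
          have "\<bar>v x - l * total_value n x\<bar> \<le> 3 * d\<^sup>2 + l * (2 * N + 6 * d * (n - p))"
            using 1 2 near[of x] by linarith
          then have "n * \<bar>v x - l * total_value n x\<bar> \<le> n * (3 * d\<^sup>2 + l * (2 * N + 6 * d * (n - p)))"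
            by (intro mult_left_mono) auto
          (* The block adds 3 * d * (d * n), which its length p pays for because d * n is at most 2 * p. *)
          also have "n * (3 * d\<^sup>2 + l * (2 * N + 6 * d * (n - p))) =
              3 * d * (d * n) + (n * l) * (2 * N + 6 * d * (n - p))"
            by (simp add: algebra_simps power2_eq_square)
          also have "\<dots> \<le> 3 * d * (2 * p) + (2 * N + 6 * d * (n - p))"
            using p(2) d l by (simp add: mult_left_mono)
          also have "\<dots> = 2 * N + 6 * d * n"
            using pn by (simp add: of_nat_diff algebra_simps)
          finally have "\<bar>n * (v x - l * total_value n x)\<bar> \<le> 2 * N + 6 * d * n"
            by (simp add: abs_mult)
          moreover have "n * (v x - l * total_value n x) = n * v x - (n * l) * total_value n x"
            by (simp add: algebra_simps)
          ultimately show ?thesis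
            using l by (simp add: abs_minus_commute)
        qed
        then show ?thesis by blast
      qed
    qed
    then show ?thesis
      by (intro exI[of _ "2 * N"]) auto
  qed
  show ?thesis
    unfolding uniform_limit_iff
  proof (intro allI impI)
    fix e :: real assume e: "0 < e"
    define d where "d = min (1 / 2) (e / 12)"
    have d: "0 < d" "d < 1" "6 * d \<le> e / 2"
      using e by (auto simp: d_def)
    then obtain N :: nat where N: "\<And>n x. \<bar>total_value n x - n * v x\<bar> \<le> N + 6 * d * n"
      using rate by blast
    obtain K :: nat where K: "2 * N / e < K"
      using reals_Archimedean2 by blast
    have "dist (total_value n x / n) (v x) < e" if n: "n \<ge> max (Suc N) K" for n x
    proof -
      have n0: "0 < n" and "2 * N / e < n"
        using n K by auto
      then have "2 * N < e * n"
        using e by (simp add: field_simps)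
      moreover have "6 * d * n \<le> e / 2 * n"
        using d by (intro mult_right_mono) auto
      ultimately have "\<bar>total_value n x - n * v x\<bar> < e * n"
        using N[of n x] by linarith
      moreover have "total_value n x / n - v x = (total_value n x - n * v x) / n"
        using n0 by (simp add: field_simps)
      ultimately show ?thesis
        using n0 by (simp add: dist_real_def divide_less_eq)
    qed
    then show "\<forall>\<^sub>F n in sequentially. \<forall>x\<in>UNIV. dist (total_value n x / n) (v x) < e"
      unfolding eventually_sequentially by blast
  qed
qed

text \<open>
  Take \<open>n\<close> close to \<open>1 / l\<close> and a block of \<open>p\<close> stages with \<open>p * l\<close> close to \<open>d\<close>. The recursion of the
  \<open>n\<close>-stage game shows that \<open>v\<close> is reproduced by the block up to \<open>O(d\<^sup>2)\<close> once \<open>v_n\<close> is within \<open>d\<^sup>2\<close>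
  of \<open>v\<close>, and by \<open>discounted_block\<close> the same holds for the block of the discounted game. That block is
  a contraction with factor at most \<open>1 - d / 4\<close>, so its fixed point \<open>u l\<close> is within
  \<open>O(d\<^sup>2) / d = O(d)\<close> of \<open>v\<close>.
\<close>

theorem discounted_values_converge:
  assumes fixpoint: "\<And>l. 0 < l \<Longrightarrow> l \<le> 1 \<Longrightarrow> discounted_step l (u l) = u l"
    and u_le: "\<And>l x. 0 < l \<Longrightarrow> l \<le> 1 \<Longrightarrow> \<bar>u l x\<bar> \<le> 1"
    and lim: "uniform_limit UNIV (\<lambda>n x. total_value n x / n) v sequentially"
  shows "uniform_limit UNIV u v (at_right 0)"
proof -
  have v_le: "\<bar>v x\<bar> \<le> 1" for x
  proof (rule tendsto_upperbound)
    show "(\<lambda>n. \<bar>total_value n x / n\<bar>) \<longlonglongrightarrow> \<bar>v x\<bar>"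
      using tendsto_uniform_limitI[OF lim] by (intro tendsto_rabs) simp
    show "\<forall>\<^sub>F n in sequentially. \<bar>total_value n x / n\<bar> \<le> 1"
      using total_bound[of _ x] by (intro always_eventually allI) (auto simp: divide_le_eq_1)
  qed simp
  have key: "\<exists>r>0. \<forall>l. 0 < l \<longrightarrow> l < r \<longrightarrow> (\<forall>x. \<bar>u l x - v x\<bar> \<le> 18 * d)" if d: "0 < d" "d < 1 / 2" for d
  proof -
    obtain N where N: "\<And>n x. n \<ge> N \<Longrightarrow> \<bar>total_value n x / n - v x\<bar> \<le> d\<^sup>2"
    proof -
      have "\<forall>\<^sub>F n in sequentially. \<forall>x\<in>UNIV. dist (total_value n x / n) (v x) < d\<^sup>2"
        using lim d unfolding uniform_limit_iff by simp
      then show ?thesis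
        using that unfolding eventually_sequentially dist_real_def by (meson UNIV_I less_imp_le)
    qed
    (* The first bound makes the rounding of n and p harmless, the second one leaves at least N
       stages after the block. *)
    define r where "r = min (d\<^sup>2 / 2) (1 / (2 * (real N + 2)))"
    have "\<bar>u l x - v x\<bar> \<le> 18 * d" if l: "0 < l" "l < r" for l x
    proof -
      have l_d: "l \<le> d\<^sup>2" "2 * l \<le> d\<^sup>2" "2 * l \<le> d"
      proof -
        show "l \<le> d\<^sup>2" "2 * l \<le> d\<^sup>2"
          using l d by (auto simp: r_def)
        moreover have "d\<^sup>2 \<le> d"
          using d by (simp add: power2_eq_square)
        ultimately show "2 * l \<le> d" by simp
      qed
      have l1: "l \<le> 1"
        using l_d d by simp
      define n where "n = nat \<lfloor>1 / l\<rfloor>"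
      define p where "p = nat \<lfloor>d / l\<rfloor>"
      have n: "n \<le> 1 / l" "1 / l < n + 1" and p: "p \<le> d / l" "d / l < p + 1"
        using l d by (simp_all add: n_def p_def) linarith+
      have nl: "n * l \<le> 1" "1 - l \<le> n * l" and pl: "p * l \<le> d" "d / 2 \<le> p * l"
        using n p l l_d by (simp_all add: field_simps)
      have np: "p \<le> n" "N \<le> n - p"
      proof -
        have "l * (2 * (real N + 2)) < 1"
          using l by (simp add: r_def less_divide_eq)
        then have "real N + 2 < 1 / l / 2"
          using l by (simp add: field_simps)
        moreover have "d / l \<le> 1 / l / 2"
          using l d by (simp add: field_simps)
        ultimately have "real p + real N \<le> real n"
          using n p by linarith
        then show "p \<le> n" "N \<le> n - p" by linarith+
      qed
      have near: "\<bar>l * total_value m y - m * l * v y\<bar> \<le> d\<^sup>2" if "N \<le> m" "m \<le> n" for m y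
      proof -
        have "m * l \<le> 1"
          using nl(1) that(2) l by (meson mult_right_mono of_nat_le_iff less_imp_le order_trans)
        moreover have "l * total_value m y - m * l * v y = m * l * (total_value m y / m - v y)"
          by (cases "m = 0") (simp_all add: algebra_simps)
        ultimately show ?thesis
          using N[OF that(1), of y] l mult_left_le_one_le[of "\<bar>total_value m y / m - v y\<bar>" "m * l"]
          by (simp add: abs_mult)
      qed
      (* Rounding changes the coefficient m * l by at most l, and l is at most d^2. *)
      have shift: "\<bar>l * total_value m y - c * v y\<bar> \<le> 2 * d\<^sup>2" if "N \<le> m" "m \<le> n" "\<bar>m * l - c\<bar> \<le> l" for m c y
      proof -
        have "\<bar>(m * l - c) * v y\<bar> \<le> l * 1"
          unfolding abs_mult using that v_le[of y] by (intro mult_mono) auto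
        then show ?thesis
          using near[OF that(1,2), of y] l_d(1) by (simp add: algebra_simps)
      qed
      have v_block: "\<bar>v y - (discounted_step l ^^ p) v y\<bar> \<le> 4 * d\<^sup>2 + (p * l)\<^sup>2" for y
      proof -
        have 1: "\<bar>l * total_value n y - v y\<bar> \<le> 2 * d\<^sup>2"
          using shift[of n 1 y] nl np by simp
        have "\<bar>l * total_value (n - p) z - (1 - p * l) * v z\<bar> \<le> 2 * d\<^sup>2" for z
          using shift[of "n - p" "1 - real p * l" z] nl np by (simp add: of_nat_diff algebra_simps)
        from funpow_nonexpansive[of "\<lambda>z. l * total_value (n - p) z" "\<lambda>z. (1 - real p * l) * v z" _ p l y l, OF this]
        have 2: "\<bar>l * total_value n y - (T l ^^ p) (\<lambda>z. (1 - p * l) * v z) y\<bar> \<le> 2 * d\<^sup>2"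
          using total_block[of l p n y] l np by simp
        have 3: "\<bar>(discounted_step l ^^ p) v y - (T l ^^ p) (\<lambda>z. (1 - p * l) * v z) y\<bar> \<le> (p * l)\<^sup>2"
          using l pl d v_le by (intro discounted_block) auto
        show ?thesis
          using 1 2 3 by linarith
      qed
      (* The supremum is an error bound that the contraction reproduces up to the factor (1 - l) ^ p. *)
      define m where "m = (SUP x. \<bar>u l x - v x\<bar>)"
      have le2: "\<bar>u l y - v y\<bar> \<le> 2" for y
        using u_le[of l y] v_le[of y] l l1 by linarith
      then have m: "\<bar>u l y - v y\<bar> \<le> m" for y
        unfolding m_def by (intro cSUP_upper bdd_aboveI2) auto
      have m0: "0 \<le> m"
        using m[of undefined] by linarith
      have "\<bar>u l y - v y\<bar> \<le> (1 - l) ^ p * m + (4 * d\<^sup>2 + (p * l)\<^sup>2)" for y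
      proof -
        have "(discounted_step l ^^ p) (u l) = u l"
          by (induction p) (simp_all add: fixpoint l l1)
        then have "\<bar>u l y - (discounted_step l ^^ p) v y\<bar> \<le> (1 - l) ^ p * m"
          using funpow_discounted_contraction[of l "u l" v _ p y, OF l1 m] by simp
        then show ?thesis
          using v_block[of y] by linarith
      qed
      then have "m \<le> (1 - l) ^ p * m + (4 * d\<^sup>2 + (p * l)\<^sup>2)"
        by (subst (1) m_def) (intro cSUP_least, auto)
      moreover have "(1 - l) ^ p * m \<le> (1 - p * l / 2) * m"
      proof (rule mult_right_mono[OF _ m0])
        have "(1 - l) ^ p \<le> exp (- l) ^ p"
          using l1 exp_ge_add_one_self[of "- l"] by (intro power_mono) auto
        also have "\<dots> = exp (- (p * l))"
          by (simp add: exp_of_nat_mult[symmetric])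
        also have "\<dots> \<le> 1 / (1 + p * l)"
          using exp_ge_add_one_self[of "p * l"] l by (simp add: exp_minus inverse_eq_divide frac_le add_pos_nonneg)
        also have "\<dots> \<le> 1 - p * l / 2"
        proof -
          have "0 \<le> (p * l) * (1 - p * l)"
            using l pl d by (intro mult_nonneg_nonneg) auto
          then have "1 \<le> (1 - p * l / 2) * (1 + p * l)"
            by (simp add: algebra_simps)
          then show ?thesis
            using l by (subst pos_divide_le_eq) (auto intro: add_pos_nonneg)
        qed
        finally show "(1 - l) ^ p \<le> 1 - p * l / 2" .
      qed
      ultimately have "p * l * m \<le> 2 * (4 * d\<^sup>2 + (p * l)\<^sup>2)"
        by (simp add: algebra_simps)
      also have "\<dots> \<le> 2 * (4 * d\<^sup>2 + (p * l) * d)"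
        using pl l by (simp add: power2_eq_square mult_left_mono)
      also have "\<dots> \<le> (p * l) * (18 * d)"
      proof -
        have "d * d \<le> 2 * (p * l) * d"
          using pl d by (intro mult_right_mono) auto
        then show ?thesis
          by (simp add: power2_eq_square algebra_simps)
      qed
      finally have "m \<le> 18 * d"
        using pl d by (subst (asm) mult_le_cancel_left_pos) auto
      with m[of x] show ?thesis by simp
    qed
    moreover have "0 < r"
      using d by (simp add: r_def)
    ultimately show ?thesis by blast
  qed
  show ?thesis
    unfolding uniform_limit_iff
  proof (intro allI impI)
    fix e :: real assume e: "0 < e"
    define d where "d = min (1 / 4) (e / 36)"
    have d: "0 < d" "d < 1 / 2" "18 * d < e"
      using e by (auto simp: d_def)
    from key[OF d(1,2)] show "\<forall>\<^sub>F l in at_right 0. \<forall>x\<in>UNIV. dist (u l x) (v x) < e"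
      unfolding eventually_at_right_field dist_real_def using d(3) by (meson order_le_less_trans)
  qed
qed

end

section \<open>Values of stochastic games\<close>

text \<open>
  Nonexpansiveness is \<open>shapley_le\<close> applied in both directions. A saddle point stays one when all
  entries of the matrix and the value are scaled by the same nonnegative factor.
\<close>

lemma homogeneous_nonexpansive_shapley:
  assumes G: "stochastic_game G"
  shows "homogeneous_nonexpansive (shapley G)"
proof
  fix f g :: "'a \<Rightarrow> real" and e s t :: real and x
  assume "\<And>x. \<bar>f x - g x\<bar> \<le> e"
  then have "f x \<le> g x + e" "g x \<le> f x + e" for x
    by (smt (verit))+
  then show "\<bar>shapley G s f x - shapley G t g x\<bar> \<le> \<bar>s - t\<bar> + e"
    using shapley_le[OF G, of f g e s x t] shapley_le[OF G, of g f e t x s] by (simp add: abs_le_iff)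
next
  fix c s :: real and f :: "'a \<Rightarrow> real"
  assume c: "0 \<le> c"
  show "shapley G (c * s) (\<lambda>x. c * f x) = (\<lambda>x. c * shapley G s f x)"
  proof
    fix x
    obtain p q where sad: "saddle (actions1 G x) (actions2 G x) (local_game G s f x) (shapley G s f x) p q"
      by (rule shapley_saddle[OF G])
    have "local_game G (c * s) (\<lambda>x. c * f x) x = (\<lambda>a b. c * local_game G s f x a b)"
      by (simp add: fun_eq_iff algebra_simps)
    moreover have "saddle (actions1 G x) (actions2 G x) (\<lambda>a b. c * local_game G s f x a b)
        (c * shapley G s f x) p q"
      using sad c unfolding saddle_def by (simp add: mult_left_mono)
    then have "matrix_value (actions1 G x) (actions2 G x) (\<lambda>a b. c * local_game G s f x a b) =
        c * shapley G s f x"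
      by (rule saddle_unique[OF stochastic_gameD(1,3)[OF G]])
    ultimately show "shapley G (c * s) (\<lambda>x. c * f x) x = c * shapley G s f x"
      by (simp add: shapley_def[of G "c * s"])
  qed
qed

context
  fixes G :: "('x, 'a, 'b) stoch_game"
  assumes G: "stochastic_game G"
begin

interpretation homogeneous_nonexpansive "shapley G"
  by (rule homogeneous_nonexpansive_shapley[OF G])

text \<open>
  Backward induction: with the weight \<open>1 / n\<close> on each stage, the continuation payoff after \<open>t\<close> stages is
  the \<open>(n - t)\<close>-fold iterate of the operator at \<open>0\<close>, and it vanishes after the last stage.
\<close>

lemma value_n_eq:
  assumes "0 < n"
  shows "value_n G n x1 = total_value n x1 / n"
proof -
  define f where "f t = (shapley G (1 / n) ^^ (n - t)) (\<lambda>_. 0)" for t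
  have f_step: "f t = shapley G (1 / n) (f (Suc t))" if "t < n" for t
    using that by (simp add: f_def Suc_diff_Suc[symmetric])
  have f_n: "f n = (\<lambda>_. 0)"
    by (simp add: f_def)
  have f_0: "f 0 x1 = total_value n x1 / n"
    using funpow_homogeneous[of "1 / n" n 1 "\<lambda>_. 0"] by (simp add: f_def)
  obtain \<sigma>' \<tau>' where opt: "\<sigma>' \<in> strategies1 G" "\<tau>' \<in> strategies2 G"
    "\<And>h x. saddle (actions1 G x) (actions2 G x) (local_game G (1 / n) (f (Suc (length h))) x)
      (shapley G (1 / n) (f (Suc (length h))) x) (\<sigma>' h x) (\<tau>' h x)"
    using saddle_strategies[OF G, of "\<lambda>_. 1 / n" f] by blast
  show ?thesis
    unfolding value_n_def
  proof (rule game_value_eqI[OF opt(1) _ opt(2)])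
    fix \<tau> assume \<tau>: "\<tau> \<in> strategies2 G"
    interpret strategy_profile G x1 \<sigma>' \<tau>
      by unfold_locales (fact G opt \<tau>)+
    show "total_value n x1 / n \<le> payoff_n G n x1 \<sigma>' \<tau>"
      using optimal1_payoff_ge[of n f "\<lambda>_. 1 / n"] f_step f_n f_0 opt(3)
      by (auto simp: payoff_n_eq continuation_def)
  next
    fix \<sigma> assume \<sigma>: "\<sigma> \<in> strategies1 G"
    interpret strategy_profile G x1 \<sigma> \<tau>'
      by unfold_locales (fact G opt \<sigma>)+
    show "payoff_n G n x1 \<sigma> \<tau>' \<le> total_value n x1 / n"
      using optimal2_payoff_le[of n f "\<lambda>_. 1 / n"] f_step f_n f_0 opt(3)
      by (auto simp: payoff_n_eq continuation_def)
  next
    fix \<sigma> \<tau> assume "\<sigma> \<in> strategies1 G" "\<tau> \<in> strategies2 G"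
    then interpret strategy_profile G x1 \<sigma> \<tau>
      using G by unfold_locales
    have "\<bar>payoff_n G n x1 \<sigma> \<tau>\<bar> \<le> (\<Sum>t<n. 1 / n)"
      unfolding payoff_n_eq
      by (rule sum_abs[THEN order_trans], intro sum_mono) (simp add: abs_mult stage_mean_abs_le divide_right_mono)
    then show "\<bar>payoff_n G n x1 \<sigma> \<tau>\<bar> \<le> 1"
      using assms by simp
  qed
qed

text \<open>
  The continuation payoff after \<open>t\<close> stages is \<open>(1 - l) ^ t * u\<close>. By homogeneity this sequence satisfies
  the recursion of the Shapley operator, and it tends to \<open>0\<close> uniformly, so the local saddle points
  guarantee \<open>u\<close> in the infinite game.
\<close>

lemma value_disc_eq:
  assumes l: "0 < l" "l \<le> 1" and u: "discounted_step l u = u" "\<And>x. \<bar>u x\<bar> \<le> 1"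
  shows "value_disc G l x1 = u x1"
proof -
  define \<theta> where "\<theta> t = l * (1 - l) ^ t" for t
  define f where "f t = (\<lambda>x. (1 - l) ^ t * u x)" for t
  have f_step: "f t = shapley G (\<theta> t) (f (Suc t))" for t
    using homogeneous[of "(1 - l) ^ t" l "\<lambda>x. (1 - l) * u x"] l u(1)
    by (simp add: f_def \<theta>_def mult_ac)
  have f_le: "\<bar>f t x\<bar> \<le> (1 - l) ^ t" for t x
    using l u(2)[of x] by (simp add: f_def abs_mult mult_left_le)
  have pow: "(\<lambda>n. (1 - l) ^ n) \<longlonglongrightarrow> 0"
    using l by (intro LIMSEQ_power_zero) simp
  obtain \<sigma>' \<tau>' where opt: "\<sigma>' \<in> strategies1 G" "\<tau>' \<in> strategies2 G"
    "\<And>h x. saddle (actions1 G x) (actions2 G x) (local_game G (\<theta> (length h)) (f (Suc (length h))) x)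
      (shapley G (\<theta> (length h)) (f (Suc (length h))) x) (\<sigma>' h x) (\<tau>' h x)"
    using saddle_strategies[OF G, of \<theta> f] by blast
  have partial_sums: "(\<lambda>n. (\<Sum>t<n. \<theta> t * strategy_profile.stage_mean G x1 \<sigma> \<tau> t) +
      strategy_profile.continuation G x1 \<sigma> \<tau> n (f n)) \<longlonglongrightarrow> payoff_disc G l x1 \<sigma> \<tau>"
    if "\<sigma> \<in> strategies1 G" "\<tau> \<in> strategies2 G" for \<sigma> \<tau>
  proof -
    interpret strategy_profile G x1 \<sigma> \<tau>
      using G that by unfold_locales
    have "(\<lambda>n. continuation n (f n)) \<longlonglongrightarrow> 0"
      using continuation_abs_le[OF f_le]
      by (intro Lim_null_comparison[OF _ pow] always_eventually) simp
    then show ?thesis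
      using tendsto_add[OF payoff_disc_sums[OF l, unfolded sums_def]] by (fastforce simp: \<theta>_def)
  qed
  show ?thesis
    unfolding value_disc_def
  proof (rule game_value_eqI[OF opt(1) _ opt(2)])
    fix \<tau> assume \<tau>: "\<tau> \<in> strategies2 G"
    interpret strategy_profile G x1 \<sigma>' \<tau>
      by unfold_locales (fact G opt \<tau>)+
    have "u x1 \<le> (\<Sum>t<n. \<theta> t * stage_mean t) + continuation n (f n)" for n
      using optimal1_payoff_ge[of n f \<theta>] f_step opt(3) by (auto simp: f_def)
    then show "u x1 \<le> payoff_disc G l x1 \<sigma>' \<tau>"
      using LIMSEQ_le_const[OF partial_sums[OF opt(1) \<tau>]] by blast
  next
    fix \<sigma> assume \<sigma>: "\<sigma> \<in> strategies1 G"
    interpret strategy_profile G x1 \<sigma> \<tau>'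
      by unfold_locales (fact G opt \<sigma>)+
    have "(\<Sum>t<n. \<theta> t * stage_mean t) + continuation n (f n) \<le> u x1" for n
      using optimal2_payoff_le[of n f \<theta>] f_step opt(3) by (auto simp: f_def)
    then show "payoff_disc G l x1 \<sigma> \<tau>' \<le> u x1"
      using LIMSEQ_le_const2[OF partial_sums[OF \<sigma> opt(2)]] by blast
  next
    fix \<sigma> \<tau> assume "\<sigma> \<in> strategies1 G" "\<tau> \<in> strategies2 G"
    then interpret strategy_profile G x1 \<sigma> \<tau>
      using G by unfold_locales
    have "\<bar>\<theta> t * stage_mean t\<bar> \<le> \<theta> t" for t
      using l stage_mean_abs_le[of t] by (simp add: \<theta>_def abs_mult mult_left_le)
    moreover have "\<theta> sums 1"
      using sums_mult[OF geometric_sums[of "1 - l"], of l] l by (simp add: \<theta>_def[abs_def])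
    moreover have "(\<lambda>t. \<theta> t * stage_mean t) sums payoff_disc G l x1 \<sigma> \<tau>"
      using payoff_disc_sums[OF l] by (simp add: \<theta>_def)
    ultimately show "\<bar>payoff_disc G l x1 \<sigma> \<tau>\<bar> \<le> 1"
      using norm_sums_le by fastforce
  qed
qed

theorem stochastic_game_tauberian:
  "uniform_limit UNIV (\<lambda>n. value_n G n) v sequentially \<longleftrightarrow>
   uniform_limit UNIV (\<lambda>l. value_disc G l) v (at_right 0)"
proof -
  have fixpoint: "discounted_step l (value_disc G l) = value_disc G l" and
    bound: "\<bar>value_disc G l x\<bar> \<le> 1" if l: "0 < l" "l \<le> 1" for l x
  proof -
    obtain u where u: "discounted_step l u = u" "\<And>x. \<bar>u x\<bar> \<le> 1"
      using discounted_fixpoint_exists[OF l] by blast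
    then have "value_disc G l = u"
      using value_disc_eq[OF l] by blast
    with u show "discounted_step l (value_disc G l) = value_disc G l" "\<bar>value_disc G l x\<bar> \<le> 1"
      by simp_all
  qed
  have "\<forall>\<^sub>F n in sequentially. \<forall>x\<in>UNIV. value_n G n x = total_value n x / n"
    by (auto simp: eventually_sequentially value_n_eq intro!: exI[of _ 1])
  then have "uniform_limit UNIV (\<lambda>n. value_n G n) v sequentially \<longleftrightarrow>
      uniform_limit UNIV (\<lambda>n x. total_value n x / n) v sequentially"
    by (intro uniform_limit_cong) simp_all
  also have "\<dots> \<longleftrightarrow> uniform_limit UNIV (\<lambda>l. value_disc G l) v (at_right 0)"
    using mean_values_converge[OF fixpoint bound] discounted_values_converge[OF fixpoint bound] by blast
  finally show ?thesis .
qed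

end

theorem corollary3p2:
  fixes G :: "('x, 'a, 'b) stoch_game"
  assumes "recursive_game G"
  shows "((\<exists>v. uniform_limit UNIV (\<lambda>n. value_n G n) v sequentially) \<longleftrightarrow>
            (\<exists>w. uniform_limit UNIV (\<lambda>l. value_disc G l) w (at_right 0)))
       \<and> (\<forall>v w. uniform_limit UNIV (\<lambda>n. value_n G n) v sequentially \<longrightarrow>
            uniform_limit UNIV (\<lambda>l. value_disc G l) w (at_right 0) \<longrightarrow> v = w)"
proof -
  have "stochastic_game G"
    using assms by (simp add: recursive_game_def)
  note tauberian = stochastic_game_tauberian[OF this]
  have "v = w" if "uniform_limit UNIV (\<lambda>n. value_n G n) v sequentially"
    "uniform_limit UNIV (\<lambda>l. value_disc G l) w (at_right 0)" for v w
  proof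
    fix x
    show "v x = w x"
      using that unfolding tauberian[symmetric]
      by (metis LIMSEQ_unique UNIV_I tendsto_uniform_limitI)
  qed
  with tauberian show ?thesis
    by blast
qed

end
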